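(* There exist universal constants $n_0,c>0$ such that the following holds. Let $n\ge n_0$ be odd and let $p\in[0,1]$ satisfy $p\ge c\,n^{-1/2}$. Let $G\sim G(n,p)$ with vertex set $V$, let the initial opinions $\{X_0(i)\}_{i\in V}$ be i.i.d. uniform on $\{-1,+1\}$ and independent of $G$, and let $X_t(i)$ evolve by majority dynamics on $G$. Then with probability at least $0.4$ over the choice of $G$ and the initial opinions, $X_4(i)=\mathrm{sgn}(\mu_0)$ for all $i\in V$.
   Context: $G(n,p)$ is the Erdős–Rényi random graph on $n$ vertices in which each edge is present independently with probability $p$. Majority dynamics on a graph $G=(V,E)$: for $t\in\{0,1,2,\dots\}$, $X_t(i)\in\{-1,+1\}$ is the opinion of vertex $i$ at time $t$, and $X_{t+1}(i)=\mathrm{sgn}\sum_{j\in\partial(i)}X_t(j)$, where $\partial(i)$ is the set of neighbors of $i$, with $i$ itself added or removed so that $|\partial(i)|$ is odd (i.e. $i$ is included exactly when its degree is even; equivalently ties are broken by keeping the existing opinion). $\mu_0=\frac1n\sum_{i\in V}X_0(i)$ is the mean of the initial opinions; it is nonzero since $n$ is odd. *)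

theory Defs
  imports "HOL-Probability.Probability"
begin

text \<open>A simple graph is given by a set \<open>E\<close> of edges, each edge being a two-element set of vertices.\<close>

definition all_edges :: "'a set \<Rightarrow> 'a set set" where
  "all_edges V = {e. e \<subseteq> V \<and> card e = 2}"

definition random_graph :: "'a set \<Rightarrow> real \<Rightarrow> 'a set set pmf" where
  "random_graph V p =
     map_pmf (\<lambda>f. {e \<in> all_edges V. f e}) (Pi_pmf (all_edges V) False (\<lambda>_. bernoulli_pmf p))"

text \<open>The value \<open>0\<close> is a dummy, taken only outside \<open>V\<close>.\<close>

definition random_opinions :: "'a set \<Rightarrow> ('a \<Rightarrow> int) pmf" where
  "random_opinions V = Pi_pmf V 0 (\<lambda>_. pmf_of_set {-1, 1})"

definition neighbors :: "'a set set \<Rightarrow> 'a \<Rightarrow> 'a set" where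
  "neighbors E i = {j. {i, j} \<in> E}"

text \<open>No vertex of a simple graph is its own neighbour, so the neighbourhood is made odd by
  adding \<open>i\<close> exactly when its degree is even. Hence the sum in \<open>majority_step\<close> is never zero
  for opinions in \<open>{-1, 1}\<close>.\<close>

definition odd_neighborhood :: "'a set set \<Rightarrow> 'a \<Rightarrow> 'a set" where
  "odd_neighborhood E i =
     (if even (card (neighbors E i)) then insert i (neighbors E i) else neighbors E i)"

definition majority_step :: "'a set set \<Rightarrow> ('a \<Rightarrow> int) \<Rightarrow> 'a \<Rightarrow> int" where
  "majority_step E X i = sgn (\<Sum>j\<in>odd_neighborhood E i. X j)"

fun majority_dynamics :: "'a set set \<Rightarrow> ('a \<Rightarrow> int) \<Rightarrow> nat \<Rightarrow> 'a \<Rightarrow> int" where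
  "majority_dynamics E X0 0 = X0"
| "majority_dynamics E X0 (Suc t) = majority_step E (majority_dynamics E X0 t)"

definition mean_opinion :: "'a set \<Rightarrow> ('a \<Rightarrow> int) \<Rightarrow> real" where
  "mean_opinion V X = (1 / real (card V)) * (\<Sum>i\<in>V. real_of_int (X i))"

end

theory Submission
  imports Defs "HOL-Real_Asymp.Real_Asymp"
begin

text \<open>
  Condition on the initial opinions and say that they sum to \<open>s > 0\<close>; changing all signs covers
  \<open>s < 0\<close>. Except with probability at most about \<open>1/4\<close>, the bound \<open>1 / sqrt (n + 1)\<close> on the point masses of
  a sum of random signs gives \<open>\<bar>s\<bar> > sqrt n / 8\<close>.

  The first step creates a bias of order \<open>sqrt p\<close>. The sum of the opinions of the neighbors of a
  vertex is \<open>W + U\<close>, where \<open>W\<close> comes from a balanced set of vertices and \<open>U\<close> counts the neighbors in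
  the surplus of the majority. The law of \<open>W\<close> is symmetric, unimodal and spread over a range of
  order \<open>sqrt (n p)\<close>, while \<open>U\<close> is of order at least \<open>p sqrt n\<close>, so the expected vote is at least
  \<open>P(\<bar>W\<bar> < u) / 2\<close> for such a \<open>u\<close>, hence at least a multiple of \<open>sqrt p\<close>
  (\<open>majority_vote_bias\<close>). The votes of two vertices depend jointly only on the edge between them, so
  their covariance is at most \<open>4 p\<close> times the probability of an almost tie
  (\<open>first_vote_covariance\<close>). Averaged over the initial opinions, almost ties have probability
  \<open>O(1 / sqrt (n p))\<close> up to an exponentially small term (\<open>almost_tie_average\<close>), so the variance of
  the sum of the votes is on average \<open>o(n\<^sup>2 p)\<close>. By Chebyshev's inequality the sum of the opinions after one
  step is, with high probability, at least \<open>n sqrt p / 4096\<close>.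

  The remaining three steps are deterministic consequences of two properties that the graph has with
  high probability: all degrees are at least \<open>n p / 2\<close>, and for all vertex sets \<open>S\<close> with
  \<open>p |S| \<ge> 4\<close> and all opinions \<open>x\<close> the sum over \<open>i\<close> in \<open>S\<close> of the opinions of the neighbors of \<open>i\<close>
  is above its mean minus \<open>4 n sqrt (p |S|)\<close> (\<open>prob_not_small_discrepancy\<close>, an exponential tail
  bound and a union bound over \<open>4 ^ n\<close> pairs). Applied to the minority after a step, the second
  property bounds its size (\<open>minority_set_small\<close>). The bias of order \<open>n sqrt p\<close> thus leaves a minority of
  size \<open>O(1 / p\<^sup>2)\<close>, which is at most \<open>n / 8\<close> when \<open>n p\<^sup>2\<close> is a large constant; the next step leaves a
  minority of size \<open>O(1 / p)\<close>, less than half of every degree; and the last step leaves none.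
\<close>

section \<open>Expectations over finitely supported distributions\<close>

lemma expectation_pair_pmf_finite:
  fixes h :: "'a \<times> 'b \<Rightarrow> real"
  assumes "finite (set_pmf M)" "finite (set_pmf N)"
  shows "measure_pmf.expectation (pair_pmf M N) h =
    measure_pmf.expectation M (\<lambda>a. measure_pmf.expectation N (\<lambda>b. h (a, b)))"
proof -
  have "measure_pmf.expectation (pair_pmf M N) h =
      (\<Sum>z\<in>set_pmf M \<times> set_pmf N. pmf (pair_pmf M N) z * h z)"
    using assms by (subst integral_measure_pmf[of "set_pmf M \<times> set_pmf N"]) auto
  also have "\<dots> = (\<Sum>a\<in>set_pmf M. \<Sum>b\<in>set_pmf N. pmf M a * pmf N b * h (a, b))"
    by (simp add: sum.cartesian_product) (auto intro!: sum.cong simp: pmf_pair)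
  also have "\<dots> = (\<Sum>a\<in>set_pmf M. pmf M a * (\<Sum>b\<in>set_pmf N. pmf N b * h (a, b)))"
    by (simp add: sum_distrib_left mult.assoc)
  also have "\<dots> = measure_pmf.expectation M (\<lambda>a. measure_pmf.expectation N (\<lambda>b. h (a, b)))"
    using assms by (simp add: integral_measure_pmf[of "set_pmf M"] integral_measure_pmf[of "set_pmf N"])
  finally show ?thesis .
qed

lemma prob_eq_expectation_of_bool:
  "measure_pmf.prob M A = measure_pmf.expectation M (\<lambda>x. of_bool (x \<in> A))"
proof -
  have "(\<lambda>x. of_bool (x \<in> A)) = (indicator A :: _ \<Rightarrow> real)"
    by (auto simp: indicator_def)
  then show ?thesis by simp
qed

lemma prob_pair_pmf_finite:
  assumes "finite (set_pmf M)" "finite (set_pmf N)"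
  shows "measure_pmf.prob (pair_pmf M N) {z. Q z} =
    measure_pmf.expectation M (\<lambda>a. measure_pmf.prob N {b. Q (a, b)})"
  by (simp add: prob_eq_expectation_of_bool expectation_pair_pmf_finite[OF assms])

lemma expectation_mono_finite:
  fixes g h :: "'a \<Rightarrow> real"
  assumes "finite (set_pmf M)" "\<And>x. x \<in> set_pmf M \<Longrightarrow> g x \<le> h x"
  shows "measure_pmf.expectation M g \<le> measure_pmf.expectation M h"
  using assms by (intro integral_mono_AE integrable_measure_pmf_finite) (auto intro: AE_pmfI)

lemma finite_set_Pi_pmf:
  assumes "finite I" "\<And>i. i \<in> I \<Longrightarrow> finite (set_pmf (P i))"
  shows "finite (set_pmf (Pi_pmf I d P))"
  using assms by (auto simp: set_Pi_pmf intro!: finite_PiE_dflt)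

lemma finite_set_Pi_bernoulli [simp]:
  "finite I \<Longrightarrow> finite (set_pmf (Pi_pmf I d (\<lambda>_. bernoulli_pmf p)))"
  by (rule finite_set_Pi_pmf) auto

section \<open>An exponential tail bound\<close>

lemma exp_le_quadratic:
  fixes y :: real
  assumes "\<bar>y\<bar> \<le> 1"
  shows "exp y \<le> 1 + y + y\<^sup>2"
proof (cases "y \<ge> 0")
  case True
  then show ?thesis using exp_bound[of y] assms by simp
next
  case False
  define z where "z = - y"
  have z: "0 \<le> z" "z \<le> 1" using False assms by (auto simp: z_def)
  have "1 \<le> (1 - z + z\<^sup>2) * (1 + z)"
    using z by (simp add: algebra_simps power2_eq_square power3_eq_cube)
  also have "\<dots> \<le> (1 - z + z\<^sup>2) * exp z"
  proof (rule mult_left_mono)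
    show "1 + z \<le> exp z" by (rule exp_ge_add_one_self)
    show "0 \<le> 1 - z + z\<^sup>2" using z by simp
  qed
  finally have "exp (- z) \<le> 1 - z + z\<^sup>2"
    by (simp add: exp_minus field_simps)
  then show ?thesis by (simp add: z_def)
qed

lemma bernoulli_centered_mgf:
  fixes p :: real and y :: real
  assumes p: "p \<in> {0..1}" and y: "\<bar>y\<bar> \<le> 1"
  shows "measure_pmf.expectation (bernoulli_pmf p) (\<lambda>b. exp (y * (of_bool b - p))) \<le> exp (p * y\<^sup>2)"
proof -
  have "measure_pmf.expectation (bernoulli_pmf p) (\<lambda>b. exp (y * (of_bool b - p)))
      = p * exp (y * (1 - p)) + (1 - p) * exp (- (y * p))"
    using p by simp
  also have "\<dots> = (1 + p * (exp y - 1)) * exp (- (y * p))"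
    by (simp add: algebra_simps flip: exp_add)
  also have "\<dots> \<le> exp (p * (exp y - 1)) * exp (- (y * p))"
    by (intro mult_right_mono exp_ge_add_one_self) auto
  also have "\<dots> = exp (p * (exp y - 1 - y))"
    by (simp add: algebra_simps flip: exp_add)
  also have "\<dots> \<le> exp (p * y\<^sup>2)"
    using exp_le_quadratic[OF y] p by (auto intro!: mult_left_mono)
  finally show ?thesis .
qed

text \<open>A Bernstein-type bound with the deviation parameter \<open>l\<close> left free. Weights of size up to
  two are needed because an edge inside a vertex set is seen from both of its ends.\<close>

lemma bernoulli_sum_lower_tail:
  fixes p :: real and w :: "'e \<Rightarrow> real"
  assumes I: "finite I" and p: "p \<in> {0..1}"
    and w: "\<And>e. e \<in> I \<Longrightarrow> \<bar>w e\<bar> \<le> 2" and B: "(\<Sum>e\<in>I. \<bar>w e\<bar>) \<le> B"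
    and l: "0 \<le> l" "l \<le> 1/2"
  shows "measure_pmf.prob (Pi_pmf I False (\<lambda>_. bernoulli_pmf p))
           {f. (\<Sum>e\<in>I. w e * (of_bool (f e) - p)) \<le> - t} \<le> exp (2 * p * l\<^sup>2 * B - l * t)"
proof -
  let ?M = "Pi_pmf I False (\<lambda>_. bernoulli_pmf p)"
  let ?D = "\<lambda>f. \<Sum>e\<in>I. w e * (of_bool (f e) - p)"
  let ?g = "\<lambda>e b. exp ((- l * w e) * (of_bool b - p))"
  have wl: "\<bar>- l * w e\<bar> \<le> 1" if "e \<in> I" for e
    using mult_mono[of l "1/2" "\<bar>w e\<bar>" 2] w[OF that] l by (simp add: abs_mult)
  have "measure_pmf.prob ?M {f. ?D f \<le> - t}
      \<le> measure_pmf.expectation ?M (\<lambda>f. exp (- l * t) * exp (- l * ?D f))"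
    unfolding prob_eq_expectation_of_bool
  proof (rule expectation_mono_finite)
    show "finite (set_pmf ?M)" using I by simp
    fix f
    have "0 \<le> - l * t + - l * ?D f" if "?D f \<le> - t"
      using mult_left_mono[OF that l(1)] by simp
    then show "of_bool (f \<in> {f. ?D f \<le> - t}) \<le> exp (- l * t) * exp (- l * ?D f)"
      by (auto simp flip: exp_add)
  qed
  also have "\<dots> = exp (- l * t) * measure_pmf.expectation ?M (\<lambda>f. \<Prod>e\<in>I. ?g e (f e))"
    using I by (simp add: exp_sum sum_distrib_left mult.assoc flip: sum_negf)
  also have "measure_pmf.expectation ?M (\<lambda>f. \<Prod>e\<in>I. ?g e (f e))
      = (\<Prod>e\<in>I. measure_pmf.expectation (bernoulli_pmf p) (?g e))"
    using I by (intro expectation_prod_Pi_pmf integrable_measure_pmf_finite) auto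
  also have "\<dots> \<le> (\<Prod>e\<in>I. exp (p * (- l * w e)\<^sup>2))"
    by (intro prod_mono conjI bernoulli_centered_mgf p wl Bochner_Integration.integral_nonneg) auto
  also have "\<dots> = exp (\<Sum>e\<in>I. p * (- l * w e)\<^sup>2)"
    using I by (simp add: exp_sum)
  also have "\<dots> \<le> exp (2 * p * l\<^sup>2 * B)"
  proof -
    have "(\<Sum>e\<in>I. p * (- l * w e)\<^sup>2) \<le> (\<Sum>e\<in>I. 2 * p * l\<^sup>2 * \<bar>w e\<bar>)"
    proof (rule sum_mono)
      fix e assume e: "e \<in> I"
      have "(w e)\<^sup>2 \<le> 2 * \<bar>w e\<bar>"
        using mult_right_mono[OF w[OF e] abs_ge_zero[of "w e"]] by (simp add: power2_eq_square)
      then have "(p * l\<^sup>2) * (w e)\<^sup>2 \<le> (p * l\<^sup>2) * (2 * \<bar>w e\<bar>)"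
        using p by (intro mult_left_mono) auto
      then show "p * (- l * w e)\<^sup>2 \<le> 2 * p * l\<^sup>2 * \<bar>w e\<bar>"
        by (simp add: power_mult_distrib mult_ac)
    qed
    also have "\<dots> = 2 * p * l\<^sup>2 * (\<Sum>e\<in>I. \<bar>w e\<bar>)"
      by (simp add: sum_distrib_left)
    also have "\<dots> \<le> 2 * p * l\<^sup>2 * B"
      using p B by (intro mult_left_mono) auto
    finally show ?thesis by simp
  qed
  finally show ?thesis
    by (simp add: mult_left_mono exp_diff exp_minus field_simps)
qed

section \<open>Discrepancy and degrees of the random graph\<close>

text \<open>The graph described by a configuration of present edges.\<close>

definition graph_of :: "'a set \<Rightarrow> ('a set \<Rightarrow> bool) \<Rightarrow> 'a set set" where
  "graph_of V f = {e \<in> all_edges V. f e}"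

text \<open>The potential edges at a vertex.\<close>

definition star :: "'a set \<Rightarrow> 'a \<Rightarrow> 'a set set" where
  "star V i = {e \<in> all_edges V. i \<in> e}"

text \<open>The value of \<open>x\<close> at the end of the edge \<open>e\<close> opposite to \<open>i\<close>, written as a sum over the
  one-element set \<open>e - {i}\<close>.\<close>

definition opposite :: "('a \<Rightarrow> 'b::comm_monoid_add) \<Rightarrow> 'a \<Rightarrow> 'a set \<Rightarrow> 'b" where
  "opposite x i e = (\<Sum>j\<in>e - {i}. x j)"

lemma random_graph_eq:
  "random_graph V p = map_pmf (graph_of V) (Pi_pmf (all_edges V) False (\<lambda>_. bernoulli_pmf p))"
  by (simp add: random_graph_def graph_of_def[abs_def])

lemma finite_all_edges [simp]: "finite V \<Longrightarrow> finite (all_edges V)"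
  unfolding all_edges_def by (rule finite_subset[of _ "Pow V"]) auto

lemma graph_of_subset: "graph_of V f \<subseteq> all_edges V"
  by (auto simp: graph_of_def)

lemma all_edges_cases:
  assumes "e \<in> all_edges V" "i \<in> e"
  obtains j where "j \<in> V" "j \<noteq> i" "e = {i, j}"
  using assms unfolding all_edges_def card_2_iff by auto

lemma doubleton_in_all_edges: "i \<in> V \<Longrightarrow> j \<in> V \<Longrightarrow> i \<noteq> j \<Longrightarrow> {i, j} \<in> all_edges V"
  by (auto simp: all_edges_def card_2_iff)

lemma bij_betw_star:
  assumes "i \<in> V"
  shows "bij_betw (\<lambda>j. {i, j}) (V - {i}) (star V i)"
proof (rule bij_betw_imageI)
  show "inj_on (\<lambda>j. {i, j}) (V - {i})"
    by (auto simp: inj_on_def doubleton_eq_iff)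
  show "(\<lambda>j. {i, j}) ` (V - {i}) = star V i"
    using assms by (auto simp: star_def doubleton_in_all_edges elim!: all_edges_cases)
qed

lemma opposite_doubleton [simp]: "j \<noteq> i \<Longrightarrow> opposite x i {i, j} = x j"
  by (simp add: opposite_def insert_Diff_if)

lemma sum_star:
  assumes "i \<in> V"
  shows "(\<Sum>e\<in>star V i. g e (opposite x i e)) = (\<Sum>j\<in>V - {i}. g {i, j} (x j))"
  by (subst sum.reindex_bij_betw[OF bij_betw_star[OF assms], symmetric]) (auto intro!: sum.cong)

text \<open>The number of edges at the vertices of \<open>S\<close>, weighted by the opinions at their far ends and
  centered at its mean.\<close>

definition deviation :: "'a set \<Rightarrow> 'a set set \<Rightarrow> real \<Rightarrow> 'a set \<Rightarrow> ('a \<Rightarrow> real) \<Rightarrow> real" where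
  "deviation V E p S x = (\<Sum>i\<in>S. \<Sum>j\<in>V - {i}. (of_bool ({i, j} \<in> E) - p) * x j)"

text \<open>The opinions in which exactly the members of \<open>T\<close> hold \<open>+ 1\<close>.\<close>

definition signs :: "'a set \<Rightarrow> 'a \<Rightarrow> real" where
  "signs T j = (if j \<in> T then 1 else - 1)"

text \<open>No large set of vertices has deviation far from zero, whatever the opinions are. A lower bound
  suffices: \<open>T\<close> ranges over all subsets, and replacing \<open>T\<close> by its complement changes the sign. Sets
  with \<open>p |S| < 4\<close> are left out because the deviation parameter \<open>1 / sqrt (p |S|)\<close> of the tail
  bound must not exceed \<open>1/2\<close>.\<close>

definition small_discrepancy :: "'a set \<Rightarrow> real \<Rightarrow> 'a set set \<Rightarrow> bool" where
  "small_discrepancy V p E \<longleftrightarrow>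
     (\<forall>S\<subseteq>V. \<forall>T\<subseteq>V. 4 \<le> p * real (card S) \<longrightarrow>
        - (4 * real (card V) * sqrt (p * real (card S))) < deviation V E p S (signs T))"

text \<open>Every degree is at least \<open>n p / 2\<close>, where \<open>n\<close> is the number of vertices; the expected degree is
  \<open>(n - 1) p\<close>.\<close>

definition large_degrees :: "'a set \<Rightarrow> real \<Rightarrow> 'a set set \<Rightarrow> bool" where
  "large_degrees V p E \<longleftrightarrow> (\<forall>i\<in>V. p * real (card V) / 2 \<le> real (card (neighbors E i)))"

lemma deviation_eq_edge_sum:
  assumes V: "finite V" and S: "S \<subseteq> V"
  shows "deviation V (graph_of V f) p S x =
    (\<Sum>e\<in>all_edges V. (\<Sum>i\<in>S \<inter> e. opposite x i e) * (of_bool (f e) - p))"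
proof -
  let ?h = "\<lambda>e. of_bool (f e) - p :: real"
  have fS: "finite S" using V S finite_subset by blast
  have "(\<Sum>e\<in>all_edges V. (\<Sum>i\<in>S \<inter> e. opposite x i e) * ?h e)
      = (\<Sum>e\<in>all_edges V. \<Sum>i\<in>S \<inter> e. opposite x i e * ?h e)"
    by (simp add: sum_distrib_right)
  also have "\<dots> = (\<Sum>e\<in>all_edges V. \<Sum>i\<in>S. if i \<in> e then opposite x i e * ?h e else 0)"
    using fS by (simp add: sum.inter_restrict)
  also have "\<dots> = (\<Sum>i\<in>S. \<Sum>e\<in>all_edges V. if i \<in> e then opposite x i e * ?h e else 0)"
    by (rule sum.swap)
  also have "\<dots> = (\<Sum>i\<in>S. \<Sum>e\<in>star V i. opposite x i e * ?h e)"
    using V by (simp add: sum.inter_filter star_def)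
  also have "\<dots> = (\<Sum>i\<in>S. \<Sum>j\<in>V - {i}. x j * ?h {i, j})"
    using S by (intro sum.cong refl sum_star[where g = "\<lambda>e y. y * ?h e"]) auto
  also have "\<dots> = deviation V (graph_of V f) p S x"
    unfolding deviation_def using S
    by (intro sum.cong refl) (auto simp: graph_of_def doubleton_in_all_edges mult.commute)
  finally show ?thesis by simp
qed

lemma card_star: "finite V \<Longrightarrow> i \<in> V \<Longrightarrow> card (star V i) = card V - 1"
  using bij_betw_same_card[OF bij_betw_star] by force

lemma deviation_lower_tail:
  fixes p :: real
  assumes V: "finite V" and S: "S \<subseteq> V" and p: "p \<in> {0..1}"
    and x: "\<And>j. j \<in> V \<Longrightarrow> \<bar>x j\<bar> = 1" and l: "0 \<le> l" "l \<le> 1/2"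
  shows "measure_pmf.prob (random_graph V p) {E. deviation V E p S x \<le> - t}
     \<le> exp (2 * p * l\<^sup>2 * (card S * card V) - l * t)"
proof -
  let ?w = "\<lambda>e. \<Sum>i\<in>S \<inter> e. opposite x i e"
  have fS: "finite S" using V S finite_subset by blast
  have opp: "\<bar>opposite x i e\<bar> = 1" if "e \<in> all_edges V" "i \<in> e" for i e
    using that x by (auto elim!: all_edges_cases)
  have absw: "\<bar>?w e\<bar> \<le> card (S \<inter> e)" if "e \<in> all_edges V" for e
  proof -
    have "\<bar>?w e\<bar> \<le> (\<Sum>i\<in>S \<inter> e. \<bar>opposite x i e\<bar>)" by (rule sum_abs)
    also have "\<dots> = (\<Sum>i\<in>S \<inter> e. 1)" using that by (intro sum.cong) (auto simp: opp)
    finally show ?thesis by simp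
  qed
  have fe: "finite e" "card e = 2" if "e \<in> all_edges V" for e
    using that by (auto simp: all_edges_def intro: card_ge_0_finite)
  have w2: "\<bar>?w e\<bar> \<le> 2" if "e \<in> all_edges V" for e
    using absw[OF that] fe[OF that] card_mono[of e "S \<inter> e"] by simp
  have B: "(\<Sum>e\<in>all_edges V. \<bar>?w e\<bar>) \<le> card S * card V"
  proof -
    have "(\<Sum>e\<in>all_edges V. \<bar>?w e\<bar>) \<le> (\<Sum>e\<in>all_edges V. real (card (S \<inter> e)))"
      by (intro sum_mono absw)
    also have "\<dots> = (\<Sum>e\<in>all_edges V. \<Sum>i\<in>S. if i \<in> e then 1 else 0)"
      using fS by (simp add: sum.inter_restrict[symmetric])
    also have "\<dots> = (\<Sum>i\<in>S. \<Sum>e\<in>all_edges V. if i \<in> e then 1 else 0)"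
      by (rule sum.swap)
    also have "\<dots> = (\<Sum>i\<in>S. real (card (star V i)))"
      using V by (simp add: star_def flip: sum.inter_filter)
    also have "\<dots> \<le> (\<Sum>i\<in>S. real (card V))"
      using V S by (intro sum_mono) (auto simp: card_star subset_iff)
    finally show ?thesis by simp
  qed
  have "measure_pmf.prob (random_graph V p) {E. deviation V E p S x \<le> - t} =
     measure_pmf.prob (Pi_pmf (all_edges V) False (\<lambda>_. bernoulli_pmf p))
       {f. (\<Sum>e\<in>all_edges V. ?w e * (of_bool (f e) - p)) \<le> - t}"
    by (simp add: random_graph_eq deviation_eq_edge_sum[OF V S] vimage_def)
  also have "\<dots> \<le> exp (2 * p * l\<^sup>2 * (card S * card V) - l * t)"
    using B by (intro bernoulli_sum_lower_tail V p w2 l finite_all_edges) auto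
  finally show ?thesis .
qed

text \<open>The union bound runs over all pairs of subsets of \<open>V\<close>, and \<open>4 < exp 2\<close>.\<close>

lemma prob_not_small_discrepancy:
  fixes p :: real
  assumes V: "finite V" and p: "p \<in> {0..1}"
  shows "measure_pmf.prob (random_graph V p) {E. \<not> small_discrepancy V p E}
    \<le> 4 ^ card V * exp (- 2 * real (card V))"
proof -
  let ?n = "card V"
  let ?P = "{(S, T). S \<subseteq> V \<and> T \<subseteq> V \<and> 4 \<le> p * card S}"
  let ?A = "\<lambda>(S, T). {E. deviation V E p S (signs T) \<le> - (4 * ?n * sqrt (p * card S))}"
  have sub: "?P \<subseteq> Pow V \<times> Pow V" by auto
  have fin: "finite ?P" by (rule finite_subset[OF sub]) (use V in auto)
  have "card ?P \<le> card (Pow V \<times> Pow V)"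
    by (rule card_mono[OF _ sub]) (use V in auto)
  also have "\<dots> = 4 ^ ?n"
    using V by (simp add: card_Pow card_cartesian_product flip: power_mult_distrib)
  finally have cardP: "card ?P \<le> 4 ^ ?n" .
  have each: "measure_pmf.prob (random_graph V p) (?A z) \<le> exp (- 2 * real ?n)" if z: "z \<in> ?P" for z
  proof -
    obtain S T where [simp]: "z = (S, T)" by (cases z)
    have S: "S \<subseteq> V" and m: "4 \<le> p * card S" using z by auto
    define r where "r = sqrt (p * card S)"
    have r2: "r\<^sup>2 = p * card S" using m by (simp add: r_def)
    have "sqrt (2\<^sup>2) \<le> r" unfolding r_def using m by (intro real_sqrt_le_mono) simp
    then have r: "2 \<le> r" by simp
    have "measure_pmf.prob (random_graph V p) (?A z)
        \<le> exp (2 * p * (1 / r)\<^sup>2 * (card S * card V) - 1 / r * (4 * ?n * r))"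
      using deviation_lower_tail[OF V S p, of "signs T" "1 / r" "4 * ?n * r"] r
      by (simp add: signs_def r_def[symmetric] field_simps)
    also have "2 * p * (1 / r)\<^sup>2 * (card S * card V) = 2 * (p * card S) / r\<^sup>2 * ?n"
      by (simp add: power_divide)
    also have "\<dots> = 2 * ?n"
      using r by (simp flip: r2)
    also have "1 / r * (4 * ?n * r) = 4 * ?n" using r by simp
    finally show ?thesis by simp
  qed
  have "{E. \<not> small_discrepancy V p E} = (\<Union>z\<in>?P. ?A z)"
    by (auto simp: small_discrepancy_def not_less)
  then have "measure_pmf.prob (random_graph V p) {E. \<not> small_discrepancy V p E}
      \<le> (\<Sum>z\<in>?P. measure_pmf.prob (random_graph V p) (?A z))"
    using measure_pmf.finite_measure_subadditive_finite[OF fin, of ?A "random_graph V p"] by simp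
  also have "\<dots> \<le> (\<Sum>z\<in>?P. exp (- 2 * real ?n))"
    by (intro sum_mono each)
  also have "\<dots> = card ?P * exp (- 2 * real ?n)"
    by simp
  also have "\<dots> \<le> 4 ^ ?n * exp (- 2 * real ?n)"
    using of_nat_mono[OF cardP, where 'a = real] by (intro mult_right_mono) auto
  finally show ?thesis .
qed

lemma neighbors_eq:
  assumes "E \<subseteq> all_edges V" "i \<in> V"
  shows "neighbors E i = {j \<in> V - {i}. {i, j} \<in> E}"
  using assms by (auto simp: neighbors_def all_edges_def)

lemma sum_neighbors:
  fixes g :: "'a \<Rightarrow> 'b::semiring_1"
  assumes "finite V" "E \<subseteq> all_edges V" "i \<in> V"
  shows "(\<Sum>j\<in>neighbors E i. g j) = (\<Sum>j\<in>V - {i}. of_bool ({i, j} \<in> E) * g j)"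
proof -
  have "(\<Sum>j\<in>neighbors E i. g j) = (\<Sum>j\<in>V - {i}. if {i, j} \<in> E then g j else 0)"
    using assms by (subst neighbors_eq[OF assms(2,3)], subst sum.inter_filter) auto
  also have "\<dots> = (\<Sum>j\<in>V - {i}. of_bool ({i, j} \<in> E) * g j)"
    by (intro sum.cong) auto
  finally show ?thesis .
qed

lemma random_graph_subset: "finite V \<Longrightarrow> E \<in> set_pmf (random_graph V p) \<Longrightarrow> E \<subseteq> all_edges V"
  by (auto simp: random_graph_def)

lemma prob_small_degree:
  fixes p :: real
  assumes V: "finite V" and p: "p \<in> {0..1}" and i: "i \<in> V" and n: "4 \<le> card V"
  shows "measure_pmf.prob (random_graph V p) {E. real (card (neighbors E i)) < p * card V / 2}
    \<le> exp (- (p * card V / 128))"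
proof -
  let ?x = "\<lambda>_::'a. 1 :: real"
  have "measure_pmf.prob (random_graph V p) {E. real (card (neighbors E i)) < p * card V / 2}
      \<le> measure_pmf.prob (random_graph V p) {E. deviation V E p {i} ?x \<le> - (p * card V / 4)}"
  proof (rule measure_pmf.finite_measure_mono_AE)
    show "AE E in random_graph V p. E \<in> {E. real (card (neighbors E i)) < p * card V / 2} \<longrightarrow>
        E \<in> {E. deviation V E p {i} ?x \<le> - (p * card V / 4)}"
    proof (rule AE_pmfI, safe)
      fix E assume E: "E \<in> set_pmf (random_graph V p)"
        and d: "real (card (neighbors E i)) < p * card V / 2"
      have "deviation V E p {i} ?x = real (card (neighbors E i)) - p * (real (card V) - 1)"
        using sum_neighbors[OF V random_graph_subset[OF V E] i, of "\<lambda>_. 1 :: real"] V i n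
        by (simp add: deviation_def sum_subtractf of_nat_diff)
      moreover have "p * 4 \<le> p * card V" using p n by (intro mult_left_mono) auto
      ultimately show "deviation V E p {i} ?x \<le> - (p * card V / 4)"
        using d by (simp add: algebra_simps)
    qed
  qed auto
  \<comment> \<open>The two terms of the exponent are then \<open>p n / 128\<close> and \<open>p n / 64\<close>.\<close>
  also have "\<dots> \<le> exp (2 * p * (1/16)\<^sup>2 * (card {i} * card V) - 1/16 * (p * card V / 4))"
    using i by (intro deviation_lower_tail V p) auto
  also have "\<dots> = exp (- (p * card V / 128))"
    by (simp add: power2_eq_square)
  finally show ?thesis .
qed

lemma prob_not_large_degrees:
  fixes p :: real
  assumes V: "finite V" and p: "p \<in> {0..1}" and n: "4 \<le> card V"
  shows "measure_pmf.prob (random_graph V p) {E. \<not> large_degrees V p E}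
    \<le> card V * exp (- (p * card V / 128))"
proof -
  have "{E. \<not> large_degrees V p E} = (\<Union>i\<in>V. {E. real (card (neighbors E i)) < p * card V / 2})"
    by (auto simp: large_degrees_def not_le)
  then have "measure_pmf.prob (random_graph V p) {E. \<not> large_degrees V p E}
      \<le> (\<Sum>i\<in>V. measure_pmf.prob (random_graph V p) {E. real (card (neighbors E i)) < p * card V / 2})"
    using measure_pmf.finite_measure_subadditive_finite[OF V,
        of "\<lambda>i. {E. real (card (neighbors E i)) < p * card V / 2}" "random_graph V p"] by simp
  also have "\<dots> \<le> (\<Sum>i\<in>V. exp (- (p * card V / 128)))"
    by (intro sum_mono prob_small_degree assms) auto
  finally show ?thesis by simp
qed

section \<open>From a small bias to unanimity\<close>

text \<open>Only the values on \<open>V\<close> are constrained.\<close>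

definition opinions :: "'a set \<Rightarrow> ('a \<Rightarrow> int) \<Rightarrow> bool" where
  "opinions V X \<longleftrightarrow> (\<forall>j\<in>V. X j = 1 \<or> X j = - 1)"

lemma even_sum_opinions:
  assumes "finite A" "opinions A X"
  shows "even (\<Sum>j\<in>A. X j) \<longleftrightarrow> even (card A)"
  using assms
proof (induction A rule: finite_induct)
  case (insert a A)
  then have "opinions A X" "odd (X a)" by (auto simp: opinions_def)
  with insert show ?case by simp
qed simp

text \<open>A tie can only occur at an even degree, and then the vertex keeps its opinion.\<close>

lemma majority_step_eq:
  assumes V: "finite V" and E: "E \<subseteq> all_edges V" and i: "i \<in> V" and X: "opinions V X"
  defines "s \<equiv> \<Sum>j\<in>neighbors E i. X j"
  shows "majority_step E X i = (if s > 0 then 1 else if s < 0 then - 1 else X i)"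
proof -
  have N: "neighbors E i \<subseteq> V" "i \<notin> neighbors E i" "finite (neighbors E i)"
    using V by (auto simp: neighbors_eq[OF E i])
  have par: "even s \<longleftrightarrow> even (card (neighbors E i))"
    unfolding s_def using N X by (intro even_sum_opinions) (auto simp: opinions_def)
  have Xi: "X i = 1 \<or> X i = - 1" using X i by (auto simp: opinions_def)
  show ?thesis
  proof (cases "even (card (neighbors E i))")
    case True
    then have "majority_step E X i = sgn (X i + s)"
      using N by (simp add: majority_step_def odd_neighborhood_def s_def)
    moreover obtain k where "s = 2 * k" using par True by (auto elim: evenE)
    ultimately show ?thesis
      using Xi by (cases "k > 0"; cases "k < 0") (auto simp: sgn_if)
  next
    case False
    then have "majority_step E X i = sgn s"
      by (simp add: majority_step_def odd_neighborhood_def s_def)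
    moreover have "s \<noteq> 0" using par False by auto
    ultimately show ?thesis by (auto simp: sgn_if)
  qed
qed

lemma opinions_majority_step:
  assumes "finite V" "E \<subseteq> all_edges V" "opinions V X"
  shows "opinions V (majority_step E X)"
  unfolding opinions_def[of V "majority_step E X"]
  using majority_step_eq[OF assms(1,2) _ assms(3)] assms(3) by (auto simp: opinions_def)

lemma majority_dynamics_uminus:
  "majority_dynamics E (\<lambda>i. - X i) t = (\<lambda>i. - majority_dynamics E X t i)"
  by (induction t) (auto simp: majority_step_def sum_negf sgn_minus)

lemma sum_opinions_eq:
  assumes V: "finite V" and X: "opinions V X"
  shows "(\<Sum>j\<in>V. real_of_int (X j)) = real (card V) - 2 * real (card {j\<in>V. X j = - 1})"
proof -
  have "(\<Sum>j\<in>V. real_of_int (X j)) = (\<Sum>j\<in>V. 1 - 2 * (if X j = - 1 then 1 else 0))"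
    using X by (intro sum.cong) (auto simp: opinions_def)
  also have "\<dots> = real (card V) - 2 * (\<Sum>j\<in>V. if X j = - 1 then 1 else 0)"
    by (simp add: sum_subtractf sum_distrib_left)
  also have "(\<Sum>j\<in>V. if X j = - 1 then 1 else 0) = real (card {j\<in>V. X j = - 1})"
    using V by (simp flip: sum.inter_filter)
  finally show ?thesis .
qed

text \<open>Each vertex that next holds the opinion \<open>- 1\<close> has neighbors with a nonpositive sum of
  opinions. If all opinions sum to \<open>\<tau>\<close>, the set \<open>S\<close> of these vertices therefore has deviation at
  most \<open>- p |S| (\<tau> - 1)\<close>, and small discrepancy bounds its size.\<close>

lemma minority_set_small:
  fixes p :: real
  assumes V: "finite V" and E: "E \<subseteq> all_edges V" and X: "opinions V X" and p: "0 \<le> p"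
    and disc: "small_discrepancy V p E"
  defines "S \<equiv> {i\<in>V. majority_step E X i = - 1}"
  assumes t: "0 < t" and tau: "t + 1 \<le> (\<Sum>j\<in>V. real_of_int (X j))"
  shows "p * card S < 4 \<or> p * card S \<le> (4 * card V / t)\<^sup>2"
proof (cases "p * card S < 4")
  case False
  define T where "T = {j\<in>V. X j = 1}"
  define r where "r = sqrt (p * card S)"
  let ?tau = "\<Sum>j\<in>V. real_of_int (X j)"
  have S: "S \<subseteq> V" by (auto simp: S_def)
  have sg: "signs T j = real_of_int (X j)" if "j \<in> V" for j
    using that X by (auto simp: signs_def T_def opinions_def)
  \<comment> \<open>The one in \<open>t + 1\<close> absorbs the opinion of \<open>i\<close> itself, which is missing from its row.\<close>
  have row: "(\<Sum>j\<in>V - {i}. (of_bool ({i, j} \<in> E) - p) * signs T j) \<le> - p * t" if i: "i \<in> S" for i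
  proof -
    have iV: "i \<in> V" using i S by auto
    have "(\<Sum>j\<in>neighbors E i. X j) \<le> 0"
      using majority_step_eq[OF V E iV X] i by (auto simp: S_def split: if_splits)
    then have "real_of_int (\<Sum>j\<in>neighbors E i. X j) \<le> 0" by (simp only: of_int_le_0_iff)
    then have "(\<Sum>j\<in>V - {i}. of_bool ({i, j} \<in> E) * real_of_int (X j)) \<le> 0"
      using sum_neighbors[OF V E iV, of "\<lambda>j. real_of_int (X j)"] by simp
    moreover have "(\<Sum>j\<in>V - {i}. real_of_int (X j)) = ?tau - X i"
      using V iV by (simp add: sum_diff1)
    moreover have "real_of_int (X i) \<le> 1" using X iV by (auto simp: opinions_def)
    ultimately have "(\<Sum>j\<in>V - {i}. of_bool ({i, j} \<in> E) * real_of_int (X j))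
        - p * (\<Sum>j\<in>V - {i}. real_of_int (X j)) \<le> - p * t"
      using tau mult_left_mono[of t "?tau - X i" p] p by simp
    moreover have "(\<Sum>j\<in>V - {i}. (of_bool ({i, j} \<in> E) - p) * signs T j)
       = (\<Sum>j\<in>V - {i}. of_bool ({i, j} \<in> E) * real_of_int (X j))
        - p * (\<Sum>j\<in>V - {i}. real_of_int (X j))"
      by (simp add: sg left_diff_distrib sum_subtractf sum_distrib_left)
    ultimately show ?thesis by simp
  qed
  have "4 \<le> p * card S" using False by simp
  then have "- (4 * card V * r) < deviation V E p S (signs T)"
    using disc S unfolding small_discrepancy_def r_def T_def by auto
  also have "\<dots> \<le> (\<Sum>i\<in>S. - p * t)"
    unfolding deviation_def by (intro sum_mono row)
  also have "\<dots> = - (r\<^sup>2 * t)"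
    using p by (simp add: r_def)
  finally have "r * (r * t) < r * (4 * card V)"
    by (simp add: power2_eq_square mult_ac)
  moreover have r: "0 \<le> r" using p by (simp add: r_def)
  ultimately have "r * t \<le> 4 * card V"
    by (metis mult_less_cancel_left not_less order_less_imp_le)
  then have "r \<le> 4 * card V / t" using t by (simp add: field_simps)
  then have "r\<^sup>2 \<le> (4 * card V / t)\<^sup>2" using r by (intro power_mono)
  then show ?thesis using p by (simp add: r_def)
qed simp

text \<open>The three steps that follow a bias of order \<open>n sqrt p\<close>: the minority first becomes a small
  fraction of the vertices, then a small fraction of a typical degree, and then disappears.\<close>

lemma unanimous_after_three_steps:
  fixes p :: real
  assumes V: "finite V" and E: "E \<subseteq> all_edges V" and X: "opinions V X" and p: "0 < p" "p \<le> 1"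
    and np2: "10^12 \<le> card V * p\<^sup>2"
    and disc: "small_discrepancy V p E" and deg: "large_degrees V p E"
    and bias: "card V * sqrt p / 4096 \<le> (\<Sum>j\<in>V. real_of_int (X j))"
    and i: "i \<in> V"
  shows "majority_dynamics E X 3 i = 1"
proof -
  define n where "n = real (card V)"
  define X1 where "X1 = majority_step E X"
  define X2 where "X2 = majority_step E X1"
  define S1 where "S1 = {i\<in>V. X1 i = - 1}"
  define S2 where "S2 = {i\<in>V. X2 i = - 1}"
  have X1: "opinions V X1" unfolding X1_def by (rule opinions_majority_step[OF V E X])
  have X2: "opinions V X2" unfolding X2_def by (rule opinions_majority_step[OF V E X1])
  have p2: "p\<^sup>2 \<le> p" using p by (simp add: power2_eq_square mult_left_le)
  have "n * p\<^sup>2 \<le> n * p" using p2 by (intro mult_left_mono) (auto simp: n_def)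
  then have np: "10^12 \<le> n * p" using np2 by (simp add: n_def)
  have "n * p \<le> n * 1" using p by (intro mult_left_mono) (auto simp: n_def)
  then have n: "10^12 \<le> n" using np by simp
  have sp: "0 < sqrt p" "(sqrt p)\<^sup>2 = p" using p by auto
  have "p \<le> sqrt p" using p p2 real_le_rsqrt by blast
  then have "n * p \<le> n * sqrt p" using n by (intro mult_left_mono) auto
  then have nsp: "10^12 \<le> n * sqrt p" using np by linarith
  have "p * card S1 < 4 \<or> p * card S1 \<le> (4 * card V / (n * sqrt p / 8192))\<^sup>2"
    unfolding S1_def X1_def
    using nsp bias p by (intro minority_set_small V E X disc) (auto simp: n_def)
  also have "(4 * card V / (n * sqrt p / 8192))\<^sup>2 = 32768\<^sup>2 / p"
    using n sp by (simp add: n_def[symmetric] power_divide)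
  finally have "p * card S1 \<le> 32768\<^sup>2 / p"
  proof (rule disjE)
    assume "p * card S1 < 4"
    moreover have "4 \<le> 32768\<^sup>2 / p" using p by (simp add: field_simps)
    ultimately show ?thesis by linarith
  qed
  then have "p\<^sup>2 * card S1 \<le> 32768\<^sup>2"
    using p by (simp add: field_simps power2_eq_square)
  also have "32768\<^sup>2 \<le> n / 8 * p\<^sup>2"
    using np2 by (simp add: n_def)
  finally have "card S1 \<le> n / 8"
    using p by (simp add: mult.commute)
  then have "n / 2 + 1 \<le> (\<Sum>j\<in>V. real_of_int (X1 j))"
    using sum_opinions_eq[OF V X1] n by (simp add: n_def S1_def)
  then have "p * card S2 < 4 \<or> p * card S2 \<le> (4 * card V / (n / 2))\<^sup>2"
    unfolding S2_def X2_def
    using n p by (intro minority_set_small V E X1 disc) (auto simp: n_def)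
  also have "(4 * card V / (n / 2))\<^sup>2 = 64"
    using n by (simp add: n_def[symmetric])
  finally have S2: "card S2 \<le> 64 / p"
    using p by (auto simp: field_simps)
  let ?N = "neighbors E i"
  have N: "?N \<subseteq> V" "finite ?N" using V by (auto simp: neighbors_eq[OF E i])
  have "real (card {j\<in>?N. X2 j = - 1}) \<le> card S2"
    using N V by (intro of_nat_mono card_mono) (auto simp: S2_def)
  moreover have "(\<Sum>j\<in>?N. real_of_int (X2 j)) = real (card ?N) - 2 * real (card {j\<in>?N. X2 j = - 1})"
    using N X2 by (intro sum_opinions_eq) (auto simp: opinions_def)
  moreover have "p * n / 2 \<le> card ?N"
    using deg i by (auto simp: large_degrees_def n_def)
  moreover have "128 / p < p * n / 2"
    using np2 p by (simp add: field_simps n_def power2_eq_square)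
  ultimately have "0 < real_of_int (\<Sum>j\<in>?N. X2 j)"
    using S2 by simp
  then have "majority_step E X2 i = 1"
    using majority_step_eq[OF V E i X2] by (simp only: of_int_0_less_iff if_True)
  then show ?thesis
    by (simp add: numeral_3_eq_3 X2_def X1_def)
qed

section \<open>The bias of one majority vote\<close>

text \<open>A distribution on the integers that is symmetric about \<open>0\<close> and whose mass does not increase
  away from \<open>0\<close>. With the mode fixed at \<open>0\<close>, the property is easily carried through the addition of
  independent lazy symmetric steps.\<close>

definition sym_unimodal :: "int pmf \<Rightarrow> bool" where
  "sym_unimodal W \<longleftrightarrow> (\<forall>k. pmf W (- k) = pmf W k) \<and> (\<forall>k\<ge>0. pmf W (k + 1) \<le> pmf W k)"

lemma sym_unimodal_step:
  assumes W: "sym_unimodal W" and q: "0 \<le> q" "q \<le> 1/4"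
    and W': "\<And>k. pmf W' k = (1 - 2 * q) * pmf W k + q * (pmf W (k - 1) + pmf W (k + 1))"
  shows "sym_unimodal W'"
  unfolding sym_unimodal_def
proof (intro conjI allI impI)
  have sym: "pmf W (- k) = pmf W k" for k using W by (simp add: sym_unimodal_def)
  have dec: "pmf W (k + 1) \<le> pmf W k" if "k \<ge> 0" for k using W that by (simp add: sym_unimodal_def)
  fix k :: int
  have "- k - 1 = - (k + 1)" "- k + 1 = - (k - 1)" by simp_all
  then have "pmf W (- k - 1) = pmf W (k + 1)" "pmf W (- k + 1) = pmf W (k - 1)"
    by (simp_all only: sym)
  then show "pmf W' (- k) = pmf W' k" by (simp add: W' sym)
  assume k: "k \<ge> 0"
  have d0: "pmf W (k + 1) \<le> pmf W k" using dec k by simp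
  have d1: "pmf W (k + 2) \<le> pmf W (k + 1)" using dec[of "k + 1"] k by (simp add: algebra_simps)
  have "(1 - 3 * q) * pmf W (k + 1) \<le> (1 - 3 * q) * pmf W k"
    using d0 q by (intro mult_left_mono) auto
  moreover have "q * pmf W (k + 2) \<le> q * pmf W (k + 1)"
    using d1 q by (intro mult_left_mono) auto
  moreover have "q * pmf W k \<le> q * pmf W (k - 1) + q * (pmf W k - pmf W (k + 1))"
  proof (cases "k = 0")
    case True
    then show ?thesis using sym[of 1] by (simp add: algebra_simps)
  next
    case False
    then have "pmf W k \<le> pmf W (k - 1)" using dec[of "k - 1"] k by simp
    then have "q * pmf W k \<le> q * pmf W (k - 1)" using q by (intro mult_left_mono) auto
    moreover have "0 \<le> q * (pmf W k - pmf W (k + 1))" using d0 q by simp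
    ultimately show ?thesis by linarith
  qed
  ultimately show "pmf W' (k + 1) \<le> pmf W' k"
    by (simp add: W' algebra_simps)
qed

text \<open>The sum of the signs \<open>y\<close> over the elements of \<open>I\<close> selected by \<open>f\<close>.\<close>

definition signed_sum :: "'e set \<Rightarrow> ('e \<Rightarrow> int) \<Rightarrow> ('e \<Rightarrow> bool) \<Rightarrow> int" where
  "signed_sum I y f = (\<Sum>e\<in>I. of_bool (f e) * y e)"

text \<open>The law of the signed sum when each element of \<open>I\<close> is selected independently with
  probability \<open>p\<close>.\<close>

definition signed_sum_pmf :: "real \<Rightarrow> 'e set \<Rightarrow> ('e \<Rightarrow> int) \<Rightarrow> int pmf" where
  "signed_sum_pmf p I y = map_pmf (signed_sum I y) (Pi_pmf I False (\<lambda>_. bernoulli_pmf p))"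

lemma pmf_signed_sum_insert:
  fixes p :: real
  assumes I: "finite I" "a \<notin> I" and p: "p \<in> {0..1}"
  shows "pmf (signed_sum_pmf p (insert a I) y) k =
    p * pmf (signed_sum_pmf p I y) (k - y a) + (1 - p) * pmf (signed_sum_pmf p I y) k"
proof -
  let ?M = "Pi_pmf I False (\<lambda>_. bernoulli_pmf p)"
  have upd: "signed_sum (insert a I) y (f(a := b)) = of_bool b * y a + signed_sum I y f" for f b
  proof -
    have "(\<Sum>e\<in>I. of_bool ((f(a := b)) e) * y e) = (\<Sum>e\<in>I. of_bool (f e) * y e)"
      using I by (intro sum.cong) auto
    then show ?thesis unfolding signed_sum_def sum.insert[OF I] by simp
  qed
  have "signed_sum_pmf p (insert a I) y =
      bind_pmf (bernoulli_pmf p) (\<lambda>b. map_pmf (\<lambda>s. of_bool b * y a + s) (signed_sum_pmf p I y))"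
    unfolding signed_sum_pmf_def Pi_pmf_insert'[OF I]
    by (simp add: map_bind_pmf upd map_pmf_comp) (simp add: map_pmf_def)
  moreover have "pmf (map_pmf (\<lambda>s. c + s) W) k = pmf W (k - c)" for c and W :: "int pmf"
    using pmf_map_inj'[of "\<lambda>s. c + s" W "k - c"] by (simp add: inj_on_def)
  ultimately show ?thesis
    using p by (simp add: pmf_bind)
qed

text \<open>With as many signs \<open>+ 1\<close> as \<open>- 1\<close> the sum is a lazy walk whose steps are symmetric, with
  \<open>P(step = 1) = P(step = -1) = p (1 - p) \<le> 1/4\<close>.\<close>

lemma sym_unimodal_balanced:
  fixes p :: real
  assumes I: "finite I" and y: "\<And>e. e \<in> I \<Longrightarrow> y e = 1 \<or> y e = - 1" and bal: "(\<Sum>e\<in>I. y e) = 0"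
    and p: "p \<in> {0..1}"
  shows "sym_unimodal (signed_sum_pmf p I y)"
  using I y bal
proof (induction I rule: finite_psubset_induct)
  case (psubset I)
  show ?case
  proof (cases "I = {}")
    case True
    then show ?thesis
      by (auto simp: signed_sum_pmf_def signed_sum_def sym_unimodal_def indicator_def)
  next
    case False
    have "\<exists>a\<in>I. y a = 1"
    proof (rule ccontr)
      assume "\<not> ?thesis"
      then have "(\<Sum>e\<in>I. y e) = (\<Sum>e\<in>I. - 1)" using psubset.prems by (intro sum.cong) auto
      then show False using psubset.prems psubset.hyps False by simp
    qed
    moreover have "\<exists>b\<in>I. y b = - 1"
    proof (rule ccontr)
      assume "\<not> ?thesis"
      then have "(\<Sum>e\<in>I. y e) = (\<Sum>e\<in>I. 1)" using psubset.prems by (intro sum.cong) auto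
      then show False using psubset.prems psubset.hyps False by simp
    qed
    ultimately obtain a b where ab: "a \<in> I" "y a = 1" "b \<in> I" "y b = - 1" by auto
    define J where "J = I - {a} - {b}"
    have J: "I = insert a (insert b J)" "a \<notin> insert b J" "b \<notin> J" "finite J" "J \<subset> I"
      using ab psubset.hyps by (auto simp: J_def)
    have "(\<Sum>e\<in>J. y e) = 0" using psubset.prems(2) J ab by simp
    then have IH: "sym_unimodal (signed_sum_pmf p J y)"
      using psubset.IH[OF J(5)] psubset.prems J by auto
    show ?thesis
    proof (rule sym_unimodal_step[OF IH, of "p * (1 - p)"])
      show "0 \<le> p * (1 - p)" using p by simp
      have "0 \<le> (p - 1/2)\<^sup>2" by simp
      then show "p * (1 - p) \<le> 1/4" by (simp add: power2_eq_square algebra_simps)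
      show "pmf (signed_sum_pmf p I y) k = (1 - 2 * (p * (1 - p))) * pmf (signed_sum_pmf p J y) k
          + p * (1 - p) * (pmf (signed_sum_pmf p J y) (k - 1) + pmf (signed_sum_pmf p J y) (k + 1))" for k
        using J ab p by (simp add: pmf_signed_sum_insert algebra_simps)
    qed
  qed
qed

text \<open>The probability \<open>P(|W| < u)\<close>.\<close>

definition window :: "int pmf \<Rightarrow> int \<Rightarrow> real" where
  "window W u = measure_pmf.prob W {- u<..<u}"

lemma sym_unimodal_mono:
  assumes W: "sym_unimodal W" and k: "\<bar>k\<bar> \<le> u"
  shows "pmf W u \<le> pmf W k"
proof -
  have "pmf W u \<le> pmf W j" if "0 \<le> j" "j \<le> u" for j
    using that(2) that(1)
  proof (induction u rule: int_ge_induct)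
    case (step i)
    then have "pmf W (i + 1) \<le> pmf W i" using W by (simp add: sym_unimodal_def)
    with step show ?case by simp
  qed simp
  from this[of "\<bar>k\<bar>"] have "pmf W u \<le> pmf W \<bar>k\<bar>" using k by simp
  also have "\<dots> = pmf W k" using W by (auto simp: sym_unimodal_def abs_if)
  finally show ?thesis .
qed

text \<open>The average mass of a point of a centered window decreases with the window.\<close>

lemma window_ratio:
  assumes W: "sym_unimodal W" and u: "1 \<le> u" "u \<le> L"
  shows "(2 * real_of_int u - 1) * window W L \<le> (2 * real_of_int L - 1) * window W u"
  using u(2)
proof (induction L rule: int_ge_induct)
  case (step L)
  have L: "1 \<le> L" using u step by simp
  have sym: "pmf W (- L) = pmf W L" using W by (simp add: sym_unimodal_def)
  have "{- (L + 1)<..<L + 1} = insert L (insert (- L) {- L<..<L})" using L by auto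
  then have suc: "window W (L + 1) = window W L + 2 * pmf W L"
    using L sym by (simp add: window_def measure_measure_pmf_finite)
  have "(2 * u - 1) * pmf W L = (\<Sum>k\<in>{- u<..<u}. pmf W L)"
    using u by simp
  also have "\<dots> \<le> (\<Sum>k\<in>{- u<..<u}. pmf W k)"
    using step by (intro sum_mono sym_unimodal_mono W) auto
  also have "\<dots> = window W u" by (simp add: window_def measure_measure_pmf_finite)
  finally have "(2 * u - 1) * pmf W L \<le> window W u" .
  with step.IH show ?case unfolding suc by (simp add: algebra_simps)
qed simp

lemma prob_uminus_sym:
  assumes W: "sym_unimodal W"
  shows "measure_pmf.prob W {u..} = measure_pmf.prob W {..- u}"
proof -
  have "map_pmf uminus W = W"
  proof (rule pmf_eqI)
    fix k
    have "pmf (map_pmf uminus W) k = pmf W (- k)"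
      using pmf_map_inj'[of uminus W "- k"] by (simp add: inj_on_def)
    then show "pmf (map_pmf uminus W) k = pmf W k" using W by (simp add: sym_unimodal_def)
  qed
  then have "measure_pmf.prob W {u..} = measure_pmf.prob (map_pmf uminus W) {u..}" by simp
  also have "\<dots> = measure_pmf.prob W {..- u}"
    by (simp add: vimage_def) (intro arg_cong[where f = "measure_pmf.prob W"], auto)
  finally show ?thesis .
qed

lemma window_eq:
  assumes W: "sym_unimodal W" and u: "1 \<le> u"
  shows "window W u = 1 - 2 * measure_pmf.prob W {..- u}"
proof -
  have "measure_pmf.prob W ({..- u} \<union> {- u<..<u} \<union> {u..}) =
      measure_pmf.prob W {..- u} + measure_pmf.prob W {- u<..<u} + measure_pmf.prob W {u..}"
    using u by (subst measure_pmf.finite_measure_Union; (subst measure_pmf.finite_measure_Union)?) auto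
  moreover have "{..- u} \<union> {- u<..<u} \<union> {u..} = UNIV" by auto
  ultimately show ?thesis using prob_uminus_sym[OF W, of u] by (simp add: window_def)
qed

text \<open>The margin of a vote with \<open>v\<close> surplus supporters, ties counting against them. Only \<open>v = 0\<close> can
  make it negative, and then it is at least \<open>- P(W = 0)\<close>.\<close>

lemma vote_margin_ge:
  assumes W: "sym_unimodal W" and u: "1 \<le> u" and v: "0 \<le> v"
  shows "window W u * (1 - 2 * of_bool (v < u)) \<le> 1 - 2 * measure_pmf.prob W {..- v}"
proof (cases "v < u")
  case False
  then have "measure_pmf.prob W {..- v} \<le> measure_pmf.prob W {..- u}"
    by (intro measure_pmf.finite_measure_mono) auto
  then show ?thesis using False window_eq[OF W u] by simp
next
  case True
  have "measure_pmf.prob W ({..0} \<union> {0<..}) = measure_pmf.prob W {..0} + measure_pmf.prob W {0<..}"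
    by (intro measure_pmf.finite_measure_Union) auto
  moreover have "measure_pmf.prob W ({0} \<union> {0<..}) = measure_pmf.prob W {0} + measure_pmf.prob W {0<..}"
    by (intro measure_pmf.finite_measure_Union) auto
  moreover have "{..0} \<union> {0<..} = (UNIV :: int set)" "{0} \<union> {0<..} = {0 :: int..}" by auto
  ultimately have "2 * measure_pmf.prob W {..0} = 1 + measure_pmf.prob W {0}"
    using prob_uminus_sym[OF W, of 0] by simp
  moreover have "measure_pmf.prob W {..- v} \<le> measure_pmf.prob W {..0}"
    using v by (intro measure_pmf.finite_measure_mono) auto
  moreover have "measure_pmf.prob W {0} \<le> window W u"
    unfolding window_def using u by (intro measure_pmf.finite_measure_mono) auto
  ultimately show ?thesis using True by simp
qed

lemma balanced_concentration:
  fixes p :: real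
  assumes I: "finite I" and y: "\<And>e. e \<in> I \<Longrightarrow> y e = 1 \<or> y e = - 1" and bal: "(\<Sum>e\<in>I. y e) = 0"
    and p: "p \<in> {0..1}" and n: "card I \<le> n" "1 \<le> n * p" and L: "6 * sqrt (n * p) \<le> of_int L"
  shows "1/2 \<le> window (signed_sum_pmf p I y) L"
proof -
  define r where "r = sqrt (n * p)"
  have r: "1 \<le> r" "r\<^sup>2 = n * p" using n by (auto simp: r_def)
  have L': "6 * r \<le> of_int L" using L by (simp add: r_def)
  have balr: "(\<Sum>e\<in>I. real_of_int (y e)) = 0" using bal by (metis of_int_0 of_int_sum)
  have eq: "(\<Sum>e\<in>I. real_of_int (y e) * (of_bool (f e) - p)) = signed_sum I y f" for f
    using balr by (simp add: signed_sum_def right_diff_distrib sum_subtractf mult.commute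
        flip: sum_distrib_left)
  have "measure_pmf.prob (signed_sum_pmf p I y) {..- L} =
     measure_pmf.prob (Pi_pmf I False (\<lambda>_. bernoulli_pmf p))
       {f. (\<Sum>e\<in>I. real_of_int (y e) * (of_bool (f e) - p)) \<le> - real_of_int L}"
    by (simp add: signed_sum_pmf_def vimage_def eq flip: of_int_minus)
  \<comment> \<open>The exponent is at most \<open>1/2 - 3\<close>.\<close>
  also have "\<dots> \<le> exp (2 * p * (1 / (2 * r))\<^sup>2 * n - 1 / (2 * r) * L)"
  proof (intro bernoulli_sum_lower_tail I p)
    have "(\<Sum>e\<in>I. \<bar>real_of_int (y e)\<bar>) = (\<Sum>e\<in>I. 1)"
      by (intro sum.cong refl) (use y in fastforce)
    then show "(\<Sum>e\<in>I. \<bar>real_of_int (y e)\<bar>) \<le> n" using n by simp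
    show "\<bar>real_of_int (y e)\<bar> \<le> 2" if "e \<in> I" for e using y[OF that] by auto
  qed (use r in \<open>auto simp: field_simps\<close>)
  also have "2 * p * (1 / (2 * r))\<^sup>2 * n = (n * p) / (2 * r\<^sup>2)"
    by (simp add: power2_eq_square)
  also have "\<dots> = 1/2" using r(1) by (simp flip: r(2))
  also have "exp (1/2 - 1 / (2 * r) * L) \<le> exp (- 5/2)"
    using L' r(1) by (simp add: field_simps)
  also have "exp (- 5/2 :: real) \<le> 1/4"
  proof -
    have "4 \<le> 1 + 5/2 + (5/2 :: real)\<^sup>2 / 2" by (simp add: power2_eq_square)
    also have "\<dots> \<le> exp (5/2)" by (rule exp_lower_Taylor_quadratic) simp
    finally show ?thesis by (simp add: exp_minus field_simps)
  qed
  finally have "measure_pmf.prob (signed_sum_pmf p I y) {..- L} \<le> 1/4" .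
  moreover have "1 \<le> L" using L' r(1) by linarith
  ultimately show ?thesis
    using window_eq[OF sym_unimodal_balanced[OF I y bal p]] by simp
qed

text \<open>The voters split into a balanced part, whose sum \<open>W\<close> is symmetric and unimodal, and a surplus
  of supporters of the majority, of whom \<open>U\<close> take part. Given \<open>U = u \<ge> 1\<close> the margin of the vote is
  \<open>P(|W| < u)\<close>, which unimodality and concentration bound below by a multiple of
  \<open>u / sqrt (n p)\<close>.\<close>

lemma majority_vote_bias:
  fixes p m :: real
  assumes I: "finite I" and y: "\<And>e. e \<in> I \<Longrightarrow> y e = 1 \<or> y e = - 1"
    and p: "p \<in> {0..1}" and n: "card I \<le> n" "1 \<le> n * p"
    and m: "64 \<le> p * m" "m \<le> sqrt n" "m \<le> (\<Sum>e\<in>I. real_of_int (y e))"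
  shows "p * m / (112 * sqrt (n * p)) \<le>
    1 - 2 * measure_pmf.prob (signed_sum_pmf p I y) {..0}"
proof -
  define P where "P = {e\<in>I. y e = 1}"
  define N where "N = {e\<in>I. y e = - 1}"
  have PN: "I = P \<union> N" "P \<inter> N = {}" "finite P" "finite N"
    using y I by (auto simp: P_def N_def)
  have sumI: "(\<Sum>e\<in>I. y e) = int (card P) - int (card N)"
  proof -
    have "(\<Sum>e\<in>I. y e) = (\<Sum>e\<in>P. y e) + (\<Sum>e\<in>N. y e)"
      using PN by (simp add: sum.union_disjoint)
    also have "(\<Sum>e\<in>P. y e) = (\<Sum>e\<in>P. 1)" by (intro sum.cong) (auto simp: P_def)
    also have "(\<Sum>e\<in>N. y e) = (\<Sum>e\<in>N. - 1)" by (intro sum.cong) (auto simp: N_def)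
    finally show ?thesis by simp
  qed
  have p0: "0 < p" using m(1) p by (cases "p = 0") auto
  have m0: "0 < m" using m(1) p0 by (smt (verit) mult_nonneg_nonpos)
  have m3: "m \<le> real_of_int (\<Sum>e\<in>I. y e)" using m(3) by simp
  then have "0 < real_of_int (\<Sum>e\<in>I. y e)" using m0 by linarith
  then have "card N \<le> card P" using sumI by linarith
  then obtain P0 where P0: "P0 \<subseteq> P" "card P0 = card N"
    by (metis obtain_subset_with_card_n)
  define J where "J = P0 \<union> N"
  define K where "K = P - P0"
  have JK: "I = J \<union> K" "J \<inter> K = {}" "finite J" "finite K"
    using PN P0 finite_subset by (auto simp: J_def K_def)
  have yK: "y e = 1" if "e \<in> K" for e using that by (auto simp: K_def P_def)
  have yJ: "y e = 1 \<or> y e = - 1" if "e \<in> J" for e using that y JK by auto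
  have cardK: "m \<le> card K"
  proof -
    have "card K = card P - card N"
      using P0 PN by (simp add: K_def card_Diff_subset finite_subset)
    then have "int (card K) = (\<Sum>e\<in>I. y e)" using sumI \<open>card N \<le> card P\<close> by simp
    then show ?thesis using m3 by (metis of_int_of_nat_eq)
  qed
  have balJ: "(\<Sum>e\<in>J. y e) = 0"
  proof -
    have "(\<Sum>e\<in>I. y e) = (\<Sum>e\<in>J. y e) + (\<Sum>e\<in>K. y e)"
      using JK by (simp add: sum.union_disjoint)
    moreover have "(\<Sum>e\<in>K. y e) = int (card K)" using yK by simp
    moreover have "int (card K) = int (card P) - int (card N)"
      using P0 PN \<open>card N \<le> card P\<close> by (simp add: K_def card_Diff_subset finite_subset)
    ultimately show ?thesis using sumI by simp
  qed
  define W where "W = signed_sum_pmf p J y"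
  \<comment> \<open>\<open>u\<close> is half the least expected surplus, and \<open>L\<close> a window holding at least half of the mass of \<open>W\<close>.\<close>
  define u where "u = \<lceil>p * m / 2\<rceil>"
  define L where "L = \<lceil>6 * sqrt (n * p)\<rceil>"
  have sW: "sym_unimodal W" unfolding W_def by (rule sym_unimodal_balanced[OF JK(3) yJ balJ p])
  let ?MJ = "Pi_pmf J False (\<lambda>_. bernoulli_pmf p)"
  let ?MK = "Pi_pmf K False (\<lambda>_. bernoulli_pmf p)"
  have u1: "1 \<le> u" using m(1) unfolding u_def by linarith
  have split: "measure_pmf.prob (signed_sum_pmf p I y) {..0} =
      measure_pmf.expectation ?MK (\<lambda>g. measure_pmf.prob W {..- signed_sum K y g})"
  proof -
    have ss: "signed_sum I y (\<lambda>e. if e \<in> K then g e else f e) = signed_sum J y f + signed_sum K y g"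
      for f g
    proof -
      have "signed_sum I y (\<lambda>e. if e \<in> K then g e else f e) =
         (\<Sum>e\<in>J. of_bool (if e \<in> K then g e else f e) * y e) +
         (\<Sum>e\<in>K. of_bool (if e \<in> K then g e else f e) * y e)"
        unfolding signed_sum_def JK(1) by (rule sum.union_disjoint[OF JK(3,4,2)])
      also have "(\<Sum>e\<in>J. of_bool (if e \<in> K then g e else f e) * y e) = signed_sum J y f"
        unfolding signed_sum_def using JK by (intro sum.cong) auto
      also have "(\<Sum>e\<in>K. of_bool (if e \<in> K then g e else f e) * y e) = signed_sum K y g"
        unfolding signed_sum_def by (intro sum.cong) auto
      finally show ?thesis .
    qed
    have "I = K \<union> J" using JK by auto
    then have "Pi_pmf I False (\<lambda>_. bernoulli_pmf p) =
        map_pmf (\<lambda>(g, f) e. if e \<in> K then g e else f e) (pair_pmf ?MK ?MJ)"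
      using Pi_pmf_union[of K J False "\<lambda>_. bernoulli_pmf p"] JK by (simp add: Int_commute)
    then have "signed_sum_pmf p I y =
        map_pmf (\<lambda>z. signed_sum J y (snd z) + signed_sum K y (fst z)) (pair_pmf ?MK ?MJ)"
      by (simp only: signed_sum_pmf_def map_pmf_comp case_prod_beta ss)
    then have "measure_pmf.prob (signed_sum_pmf p I y) {..0} =
       measure_pmf.prob (pair_pmf ?MK ?MJ) {z. signed_sum J y (snd z) + signed_sum K y (fst z) \<le> 0}"
      by (simp add: vimage_def)
    also have "\<dots> = measure_pmf.expectation ?MK (\<lambda>g.
        measure_pmf.prob ?MJ {f. signed_sum J y f + signed_sum K y g \<le> 0})"
      using JK by (subst prob_pair_pmf_finite) auto
    also have "\<dots> = measure_pmf.expectation ?MK (\<lambda>g. measure_pmf.prob W {..- signed_sum K y g})"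
    proof -
      have "measure_pmf.prob ?MJ {f. signed_sum J y f + signed_sum K y g \<le> 0} =
         measure_pmf.prob W {..- signed_sum K y g}" for g
        unfolding W_def signed_sum_pmf_def measure_map_pmf
        by (intro arg_cong[where f = "measure_pmf.prob ?MJ"]) (auto simp: vimage_def)
      then show ?thesis by simp
    qed
    finally show ?thesis .
  qed
  have surplus: "measure_pmf.prob ?MK {g. signed_sum K y g < u} \<le> 1/4"
  proof -
    have ssK: "real_of_int (signed_sum K y g) = (\<Sum>e\<in>K. 1 * (of_bool (g e) - p)) + p * card K" for g
    proof -
      have "real_of_int (signed_sum K y g) = (\<Sum>e\<in>K. of_bool (g e))"
        using yK by (simp add: signed_sum_def)
      then show ?thesis by (simp add: sum_subtractf)
    qed
    have "measure_pmf.prob ?MK {g. signed_sum K y g < u} \<le>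
       measure_pmf.prob ?MK {g. (\<Sum>e\<in>K. 1 * (of_bool (g e) - p)) \<le> - (p * card K / 2)}"
    proof (intro measure_pmf.finite_measure_mono subsetI CollectI)
      fix g assume "g \<in> {g. signed_sum K y g < u}"
      then have "real_of_int (signed_sum K y g) \<le> p * m / 2"
        unfolding u_def by (simp add: less_ceiling_iff)
      moreover have "p * m \<le> p * card K" using cardK p0 by simp
      ultimately show "(\<Sum>e\<in>K. 1 * (of_bool (g e) - p)) \<le> - (p * card K / 2)"
        unfolding ssK by simp
    qed simp
    also have "\<dots> \<le> exp (2 * p * (1/8)\<^sup>2 * card K - 1/8 * (p * card K / 2))"
      by (intro bernoulli_sum_lower_tail JK p) auto
    also have "\<dots> = exp (- (p * card K / 32))"
      by (simp add: power2_eq_square)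
    also have "\<dots> \<le> exp (- 2)"
    proof -
      have "p * m \<le> p * card K" using cardK p0 by simp
      then have "64 \<le> p * card K" using m(1) by linarith
      then show ?thesis by simp
    qed
    also have "exp (- 2 :: real) \<le> 1/4"
    proof -
      have "4 \<le> 1 + 2 + (2 :: real)\<^sup>2 / 2" by (simp add: power2_eq_square)
      also have "\<dots> \<le> exp 2" by (rule exp_lower_Taylor_quadratic) simp
      finally show ?thesis by (simp add: exp_minus field_simps)
    qed
    finally show ?thesis .
  qed
  have uL: "u \<le> L"
  proof -
    have "p * m / 2 \<le> p * sqrt n" using m p0 m0 by (simp add: field_simps)
    also have "p \<le> sqrt p" using p by (intro real_le_rsqrt) (simp add: power2_eq_square mult_left_le)
    then have "p * sqrt n \<le> sqrt p * sqrt n" by (intro mult_right_mono) auto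
    also have "\<dots> = sqrt (n * p)" by (simp add: real_sqrt_mult mult.commute)
    also have "\<dots> \<le> 6 * sqrt (n * p)" using n by simp
    finally show ?thesis unfolding u_def L_def by (rule ceiling_mono)
  qed
  define r where "r = sqrt (n * p)"
  have r1: "1 \<le> r" using n by (simp add: r_def)
  have Lr: "6 * r \<le> L" "L \<le> 7 * r" using r1 unfolding L_def r_def[symmetric] by linarith+
  have wL: "1/2 \<le> window W L"
    unfolding W_def
  proof (rule balanced_concentration[OF JK(3) yJ balJ p])
    show "card J \<le> n" using n card_mono[OF I, of J] JK by auto
  qed (use n Lr in \<open>auto simp: r_def\<close>)
  have "u / (4 * L) \<le> window W u"
  proof -
    have "real_of_int u * (1/2) \<le> (2 * real_of_int u - 1) * window W L"
      using wL u1 by (intro mult_mono) auto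
    also have "\<dots> \<le> (2 * real_of_int L - 1) * window W u"
      by (rule window_ratio[OF sW u1 uL])
    also have "\<dots> \<le> (2 * real_of_int L) * window W u"
      by (intro mult_right_mono) (auto simp: window_def)
    finally show ?thesis using u1 uL by (simp add: field_simps)
  qed
  moreover have "(p * m / 2) / (4 * (7 * r)) \<le> u / (4 * L)"
    using Lr r1 u1 p0 m0 m(1) by (intro frac_le) (auto simp: u_def)
  ultimately have win: "p * m / (56 * r) \<le> window W u" by simp
  have "window W u * (1/2) \<le> window W u * (1 - 2 * measure_pmf.prob ?MK {g. signed_sum K y g < u})"
  proof (rule mult_left_mono)
    show "1/2 \<le> 1 - 2 * measure_pmf.prob ?MK {g. signed_sum K y g < u}" using surplus by linarith
  qed (simp add: window_def)
  also have "\<dots> = measure_pmf.expectation ?MK (\<lambda>g. window W u * (1 - 2 * of_bool (signed_sum K y g < u)))"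
    using JK unfolding prob_eq_expectation_of_bool by (simp add: integrable_measure_pmf_finite)
  also have "\<dots> \<le> measure_pmf.expectation ?MK (\<lambda>g. 1 - 2 * measure_pmf.prob W {..- signed_sum K y g})"
  proof (rule expectation_mono_finite)
    fix g
    have "0 \<le> signed_sum K y g" using yK by (auto simp: signed_sum_def intro!: sum_nonneg)
    then show "window W u * (1 - 2 * of_bool (signed_sum K y g < u))
        \<le> 1 - 2 * measure_pmf.prob W {..- signed_sum K y g}"
      by (rule vote_margin_ge[OF sW u1])
  qed (use JK in simp)
  also have "\<dots> = 1 - 2 * measure_pmf.prob (signed_sum_pmf p I y) {..0}"
    unfolding split using JK by (simp add: integrable_measure_pmf_finite)
  finally show ?thesis using win by (simp add: r_def)
qed

section \<open>Anti-concentration of sums of random opinions\<close>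

lemma central_binomial_le: "real (2 * m choose m) / 4 ^ m \<le> 1 / sqrt (real (2 * m + 1))"
proof -
  have "(real (2 * m choose m) / 4 ^ m)\<^sup>2 * real (2 * m + 1) \<le> 1"
  proof (induction m)
    case (Suc m)
    have step: "real (2 * Suc m choose Suc m) =
      real (2 * m choose m) * (2 * real (2 * m + 1) / real (m + 1))"
    proof -
      have "Suc m * (2 * Suc m choose Suc m) = (2 * Suc m) * (Suc (2 * m) choose m)"
        using Suc_times_binomial[of m "Suc (2 * m)"] by simp
      moreover have "Suc m * (Suc (2 * m) choose m) = Suc (2 * m) * (2 * m choose m)"
        using Suc_times_binomial_eq[of "2 * m" m] binomial_symmetric[of m "Suc (2 * m)"]
        by (simp add: mult.commute)
      ultimately have "Suc m * (Suc m * (2 * Suc m choose Suc m)) =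
          Suc m * (2 * (Suc (2 * m) * (2 * m choose m)))"
        by (metis mult.assoc mult.left_commute)
      then have "Suc m * (2 * Suc m choose Suc m) = 2 * (Suc (2 * m) * (2 * m choose m))"
        by (simp only: mult_cancel1) simp
      then have "real (Suc m) * real (2 * Suc m choose Suc m) = 2 * (real (Suc (2 * m)) * real (2 * m choose m))"
        by (metis of_nat_mult of_nat_numeral)
      then show ?thesis by (simp add: field_simps)
    qed
    define c where "c = real (2 * m choose m) / 4 ^ m"
    have "x * (2 * y / z) / (4 * w) = x / w * (y / (2 * z))" for x y z w :: real
      by simp
    then have "real (2 * Suc m choose Suc m) / 4 ^ Suc m = c * (real (2 * m + 1) / (2 * real (m + 1)))"
      unfolding step c_def power_Suc .
    then have "(real (2 * Suc m choose Suc m) / 4 ^ Suc m)\<^sup>2 * real (2 * Suc m + 1)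
        = (c * (real (2 * m + 1) / (2 * real (m + 1))))\<^sup>2 * real (2 * Suc m + 1)"
      by (simp only:)
    also have "\<dots> = (c\<^sup>2 * real (2 * m + 1)) *
        (real (2 * m + 1) * real (2 * Suc m + 1) / (2 * real (m + 1))\<^sup>2)"
      by (simp only: power_mult_distrib power_divide power2_eq_square times_divide_eq_right
          times_divide_eq_left
          divide_divide_eq_left mult_ac)
    also have "\<dots> \<le> 1 * 1"
    proof (intro mult_mono Suc.IH[folded c_def])
      have "real (2 * m + 1) * real (2 * Suc m + 1) \<le> (2 * real (m + 1))\<^sup>2"
        by (simp add: power2_eq_square algebra_simps)
      then show "real (2 * m + 1) * real (2 * Suc m + 1) / (2 * real (m + 1))\<^sup>2 \<le> 1"
        by (subst divide_le_eq_1_pos) auto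
    qed auto
    finally show ?case by simp
  qed simp
  then have "(real (2 * m choose m) / 4 ^ m)\<^sup>2 \<le> (1 / sqrt (real (2 * m + 1)))\<^sup>2"
    by (simp add: field_simps)
  then show ?thesis
    by (rule power2_le_imp_le) simp
qed

lemma binomial_le_inverse_sqrt: "real (d choose k) / 2 ^ d \<le> 1 / sqrt (real (d + 1))"
proof -
  have "real (d choose k) / 2 ^ d \<le> real (d choose (d div 2)) / 2 ^ d"
    by (intro divide_right_mono) (auto simp: binomial_maximum)
  also have "\<dots> \<le> 1 / sqrt (real (d + 1))"
  proof (cases "even d")
    case True
    then obtain m where "d = 2 * m" by blast
    then show ?thesis using central_binomial_le[of m] by (simp add: power_mult add.commute)
  next
    case False
    then obtain m where d: "d = 2 * m + 1" by (blast elim: oddE)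
    have "2 * (d choose (d div 2)) = (2 * Suc m choose Suc m)"
      using d binomial_symmetric[of m "Suc (2 * m)"] by simp
    then have "2 * real (d choose (d div 2)) = real (2 * Suc m choose Suc m)"
      by (metis of_nat_mult of_nat_numeral)
    moreover have "(2 ^ d :: real) = 2 * 4 ^ m" by (simp add: d power_mult)
    ultimately have "real (d choose (d div 2)) / 2 ^ d = real (2 * Suc m choose Suc m) / 4 ^ Suc m"
      by (simp add: field_simps)
    also have "\<dots> \<le> 1 / sqrt (real (2 * Suc m + 1))"
      using central_binomial_le[of "Suc m"] by simp
    also have "\<dots> \<le> 1 / sqrt (real (d + 1))"
      using d by (intro divide_left_mono) auto
    finally show ?thesis .
  qed
  finally show ?thesis .
qed

lemma set_random_opinions:
  assumes "finite V"
  shows "set_pmf (random_opinions V) = PiE_dflt V 0 (\<lambda>_. {- 1, 1})"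
  using assms by (simp add: random_opinions_def set_Pi_pmf comp_def)

lemma finite_set_random_opinions [simp]: "finite V \<Longrightarrow> finite (set_pmf (random_opinions V))"
  by (simp add: set_random_opinions finite_PiE_dflt)

lemma opinions_random_opinions:
  assumes "finite V" "X \<in> set_pmf (random_opinions V)"
  shows "opinions V X"
  using assms by (auto simp: set_random_opinions PiE_dflt_def opinions_def)

text \<open>A sum of \<open>d\<close> signs equals \<open>k\<close> for at most one value \<open>(k + d) div 2\<close> of the number of plus
  signs.\<close>

lemma prob_opinion_sum_eq_all:
  assumes D: "finite D"
  shows "measure_pmf.prob (random_opinions D) {X. (\<Sum>j\<in>D. X j) = k} \<le> 1 / sqrt (real (card D + 1))"
proof -
  let ?F = "PiE_dflt D 0 (\<lambda>_. {- 1, 1 :: int})"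
  define m where "m = nat ((k + card D) div 2)"
  have fF: "finite ?F" using D by (intro finite_PiE_dflt) auto
  have "random_opinions D = pmf_of_set ?F"
    unfolding random_opinions_def using D by (intro Pi_pmf_of_set) auto
  then have "measure_pmf.prob (random_opinions D) {X. (\<Sum>j\<in>D. X j) = k} =
      card (?F \<inter> {X. (\<Sum>j\<in>D. X j) = k}) / card ?F"
    using fF by (simp add: measure_pmf_of_set PiE_dflt_empty_iff)
  also have "card ?F = 2 ^ card D"
    using D by (simp add: card_PiE_dflt numeral_2_eq_2)
  also have "card (?F \<inter> {X. (\<Sum>j\<in>D. X j) = k}) \<le> card {T. T \<subseteq> D \<and> card T = m}"
  proof (rule card_inj_on_le[where f = "\<lambda>X. {j\<in>D. X j = 1}"])
    show "inj_on (\<lambda>X. {j\<in>D. X j = 1}) (?F \<inter> {X. (\<Sum>j\<in>D. X j) = k})"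
    proof (rule inj_onI, rule ext)
      fix X Y j
      assume X: "X \<in> ?F \<inter> {X. (\<Sum>j\<in>D. X j) = k}" and Y: "Y \<in> ?F \<inter> {X. (\<Sum>j\<in>D. X j) = k}"
        and eq: "{j\<in>D. X j = 1} = {j\<in>D. Y j = 1}"
      have F: "if j \<in> D then Z j = - 1 \<or> Z j = 1 else Z j = 0" if "Z \<in> ?F" for Z
        using that by (auto simp: PiE_dflt_def)
      have "j \<in> D \<Longrightarrow> X j = 1 \<longleftrightarrow> Y j = 1" using eq by blast
      then show "X j = Y j" using F[of X] F[of Y] X Y by (auto split: if_splits)
    qed
    show "(\<lambda>X. {j\<in>D. X j = 1}) ` (?F \<inter> {X. (\<Sum>j\<in>D. X j) = k}) \<subseteq> {T. T \<subseteq> D \<and> card T = m}"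
    proof clarsimp
      fix X assume X: "X \<in> ?F" and k: "k = (\<Sum>j\<in>D. X j)"
      have "(\<Sum>j\<in>D. X j) = (\<Sum>j\<in>D. 2 * (if X j = 1 then 1 else 0) - 1)"
        using X by (intro sum.cong) (auto simp: PiE_dflt_def)
      also have "\<dots> = 2 * int (card {j\<in>D. X j = 1}) - int (card D)"
        using D by (simp add: sum_subtractf flip: sum_distrib_left sum.inter_filter)
      finally show "card {j\<in>D. X j = 1} = m" by (simp add: m_def k)
    qed
    show "finite {T. T \<subseteq> D \<and> card T = m}" using D by simp
  qed
  also have "card {T. T \<subseteq> D \<and> card T = m} = card D choose m"
    using D by (rule n_subsets)
  finally have "measure_pmf.prob (random_opinions D) {X. (\<Sum>j\<in>D. X j) = k}
      \<le> real (card D choose m) / 2 ^ card D"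
    by (simp add: divide_right_mono)
  also have "\<dots> \<le> 1 / sqrt (real (card D + 1))"
    by (rule binomial_le_inverse_sqrt)
  finally show ?thesis .
qed

lemma prob_opinion_sum_eq:
  assumes V: "finite V" and D: "D \<subseteq> V"
  shows "measure_pmf.prob (random_opinions V) {X. (\<Sum>j\<in>D. X j) = k} \<le> 1 / sqrt (real (card D + 1))"
proof -
  have sub: "random_opinions D = map_pmf (\<lambda>X j. if j \<in> D then X j else 0) (random_opinions V)"
    unfolding random_opinions_def by (rule Pi_pmf_subset[OF V D])
  have "measure_pmf.prob (random_opinions V) {X. (\<Sum>j\<in>D. X j) = k} =
      measure_pmf.prob (random_opinions D) {X. (\<Sum>j\<in>D. X j) = k}"
    by (simp add: sub vimage_def)
  then show ?thesis using prob_opinion_sum_eq_all[of D k] V D finite_subset by auto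
qed

lemma prob_opinion_sum_le:
  assumes V: "finite V" and D: "D \<subseteq> V" and b: "0 \<le> b"
  shows "measure_pmf.prob (random_opinions V) {X. \<bar>\<Sum>j\<in>D. real_of_int (X j)\<bar> \<le> b}
     \<le> (2 * b + 1) / sqrt (real (card D + 1))"
proof -
  let ?A = "\<lambda>k. {X. (\<Sum>j\<in>D. X j) = k}"
  have "{X. \<bar>\<Sum>j\<in>D. real_of_int (X j)\<bar> \<le> b} \<subseteq> (\<Union>k\<in>{- \<lfloor>b\<rfloor>..\<lfloor>b\<rfloor>}. ?A k)"
  proof
    fix X :: "'a \<Rightarrow> int" assume "X \<in> {X. \<bar>\<Sum>j\<in>D. real_of_int (X j)\<bar> \<le> b}"
    then have "real_of_int \<bar>\<Sum>j\<in>D. X j\<bar> \<le> b" by simp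
    then have "\<bar>\<Sum>j\<in>D. X j\<bar> \<le> \<lfloor>b\<rfloor>" by (simp only: le_floor_iff)
    then show "X \<in> (\<Union>k\<in>{- \<lfloor>b\<rfloor>..\<lfloor>b\<rfloor>}. ?A k)" by (simp add: abs_le_iff)
  qed
  then have "measure_pmf.prob (random_opinions V) {X. \<bar>\<Sum>j\<in>D. real_of_int (X j)\<bar> \<le> b}
      \<le> measure_pmf.prob (random_opinions V) (\<Union>k\<in>{- \<lfloor>b\<rfloor>..\<lfloor>b\<rfloor>}. ?A k)"
    by (intro measure_pmf.finite_measure_mono) auto
  also have "\<dots> \<le> (\<Sum>k\<in>{- \<lfloor>b\<rfloor>..\<lfloor>b\<rfloor>}. measure_pmf.prob (random_opinions V) (?A k))"
    by (intro measure_pmf.finite_measure_subadditive_finite) auto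
  also have "\<dots> \<le> (\<Sum>k\<in>{- \<lfloor>b\<rfloor>..\<lfloor>b\<rfloor>}. 1 / sqrt (real (card D + 1)))"
    by (intro sum_mono prob_opinion_sum_eq V D)
  also have "\<dots> = of_int (2 * \<lfloor>b\<rfloor> + 1) / sqrt (real (card D + 1))"
    using b by simp
  also have "\<dots> \<le> (2 * b + 1) / sqrt (real (card D + 1))"
    by (intro divide_right_mono) auto
  finally show ?thesis .
qed

section \<open>Correlations between the first votes\<close>

text \<open>Two functions that share a single random bit \<open>f a\<close> have small covariance, unless the first
  one often depends on that bit. With \<open>u b\<close> and \<open>v b\<close> for the conditional expectations given
  \<open>f a = b\<close>, the covariance is \<open>p (1 - p) (u True - u False) (v True - v False)\<close>.\<close>

lemma covariance_shared_bit:
  fixes p :: real and g h :: "('e \<Rightarrow> bool) \<Rightarrow> real"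
  assumes I: "finite I" and a: "a \<in> I" "a \<notin> A" "a \<notin> B" and AB: "A \<subseteq> I" "A \<inter> B = {}"
    and p: "p \<in> {0..1}"
    and g: "\<And>f f'. (\<And>e. e \<in> insert a A \<Longrightarrow> f e = f' e) \<Longrightarrow> g f = g f'" "\<And>f. \<bar>g f\<bar> \<le> 1"
    and h: "\<And>f f'. (\<And>e. e \<in> insert a B \<Longrightarrow> f e = f' e) \<Longrightarrow> h f = h f'" "\<And>f. \<bar>h f\<bar> \<le> 1"
  defines "M \<equiv> Pi_pmf I False (\<lambda>_. bernoulli_pmf p)"
  shows "measure_pmf.expectation M (\<lambda>f. g f * h f)
      - measure_pmf.expectation M g * measure_pmf.expectation M h
    \<le> 4 * p * measure_pmf.prob M {f. g (f(a := True)) \<noteq> g (f(a := False))}"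
proof -
  \<comment> \<open>The coordinates in \<open>C\<close> include those in \<open>B\<close> and are independent of those in \<open>A\<close>.\<close>
  define C where "C = I - A - {a}"
  define MA where "MA = Pi_pmf A False (\<lambda>_. bernoulli_pmf p)"
  define MC where "MC = Pi_pmf C False (\<lambda>_. bernoulli_pmf p)"
  have fin: "finite A" "finite C" using I AB finite_subset by (auto simp: C_def)
  have finM: "finite (set_pmf MA)" "finite (set_pmf MC)" using fin by (auto simp: MA_def MC_def)
  have I_eq: "I = insert a (A \<union> C)" "a \<notin> A \<union> C" "finite (A \<union> C)" "A \<inter> C = {}"
    using a AB fin by (auto simp: C_def)
  let ?merge = "\<lambda>b s t. (\<lambda>e. if e \<in> A then s e else t e)(a := b)"
  have M_eq: "M = map_pmf (\<lambda>z. ?merge (fst z) (fst (snd z)) (snd (snd z)))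
      (pair_pmf (bernoulli_pmf p) (pair_pmf MA MC))"
  proof -
    have "M = map_pmf (\<lambda>(y, f). f(a := y)) (pair_pmf (bernoulli_pmf p)
        (map_pmf (\<lambda>(s, t) e. if e \<in> A then s e else t e) (pair_pmf MA MC)))"
      unfolding M_def I_eq(1) Pi_pmf_insert[OF I_eq(3,2)] Pi_pmf_union[OF fin I_eq(4)] MA_def MC_def ..
    then show ?thesis
      by (simp add: pair_map_pmf2 map_pmf_comp case_prod_beta)
  qed
  have E: "measure_pmf.expectation M G =
      p * measure_pmf.expectation MA (\<lambda>s. measure_pmf.expectation MC (\<lambda>t. G (?merge True s t)))
      + (1 - p) * measure_pmf.expectation MA (\<lambda>s. measure_pmf.expectation MC (\<lambda>t. G (?merge False s t)))"
    for G :: "_ \<Rightarrow> real"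
    unfolding M_eq using p finM by (simp add: expectation_pair_pmf_finite)
  have gm: "g (?merge b s t) = g (s(a := b))" for b s t using a by (intro g(1)) auto
  have hm: "h (?merge b s t) = h (t(a := b))" for b s t using AB by (intro h(1)) auto
  define u where "u b = measure_pmf.expectation MA (\<lambda>s. g (s(a := b)))" for b
  define v where "v b = measure_pmf.expectation MC (\<lambda>t. h (t(a := b)))" for b
  have Eg: "measure_pmf.expectation M g = p * u True + (1 - p) * u False"
    by (simp add: E gm u_def)
  have Eh: "measure_pmf.expectation M h = p * v True + (1 - p) * v False"
    by (simp add: E hm v_def)
  have Egh: "measure_pmf.expectation M (\<lambda>f. g f * h f) = p * (u True * v True) + (1 - p) * (u False * v False)"
    by (simp add: E gm hm u_def v_def)
  define piv where "piv = measure_pmf.prob M {f. g (f(a := True)) \<noteq> g (f(a := False))}"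
  have piv: "piv = measure_pmf.expectation MA (\<lambda>s. of_bool (g (s(a := True)) \<noteq> g (s(a := False))))"
  proof -
    have gm': "g ((?merge b s t)(a := c)) = g (s(a := c))" for b c s t using a by (intro g(1)) auto
    show ?thesis
      unfolding piv_def prob_eq_expectation_of_bool E mem_Collect_eq gm' by (simp add: algebra_simps)
  qed
  have "\<bar>u True - u False\<bar> = \<bar>measure_pmf.expectation MA (\<lambda>s. g (s(a := True)) - g (s(a := False)))\<bar>"
    unfolding u_def using finM by (simp add: integrable_measure_pmf_finite)
  also have "\<dots> \<le> measure_pmf.expectation MA (\<lambda>s. \<bar>g (s(a := True)) - g (s(a := False))\<bar>)"
    by (rule integral_abs_bound)
  also have "\<dots> \<le> measure_pmf.expectation MA (\<lambda>s. 2 * of_bool (g (s(a := True)) \<noteq> g (s(a := False))))"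
  proof (rule expectation_mono_finite[OF finM(1)])
    fix s
    show "\<bar>g (s(a := True)) - g (s(a := False))\<bar> \<le> 2 * of_bool (g (s(a := True)) \<noteq> g (s(a := False)))"
      using g(2)[of "s(a := True)"] g(2)[of "s(a := False)"] by auto
  qed
  also have "\<dots> = 2 * piv" by (simp add: piv)
  finally have du: "\<bar>u True - u False\<bar> \<le> 2 * piv" .
  have vb: "\<bar>v b\<bar> \<le> 1" for b
  proof -
    have "\<bar>v b\<bar> \<le> measure_pmf.expectation MC (\<lambda>t. \<bar>h (t(a := b))\<bar>)"
      unfolding v_def by (rule integral_abs_bound)
    also have "\<dots> \<le> measure_pmf.expectation MC (\<lambda>t. 1)"
      by (rule expectation_mono_finite[OF finM(2)]) (rule h(2))
    finally show ?thesis by simp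
  qed
  have dv: "\<bar>v True - v False\<bar> \<le> 2" using vb[of True] vb[of False] by linarith
  have "measure_pmf.expectation M (\<lambda>f. g f * h f)
      - measure_pmf.expectation M g * measure_pmf.expectation M h
    = (p * (1 - p)) * ((u True - u False) * (v True - v False))"
    unfolding Eg Eh Egh by (simp add: algebra_simps)
  also have "\<dots> \<le> (p * (1 - p)) * (\<bar>u True - u False\<bar> * \<bar>v True - v False\<bar>)"
    using p by (intro mult_left_mono) (auto simp flip: abs_mult)
  also have "\<dots> \<le> p * (2 * piv * 2)"
    using p du dv by (intro mult_mono) (auto simp: mult_left_le)
  finally show ?thesis by (simp add: piv_def)
qed

section \<open>The first vote\<close>

lemma finite_set_random_graph [simp]: "finite V \<Longrightarrow> finite (set_pmf (random_graph V p))"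
  by (simp add: random_graph_eq)

lemma neighbor_sum_eq_signed_sum:
  assumes V: "finite V" and i: "i \<in> V"
  shows "(\<Sum>j\<in>neighbors (graph_of V f) i. X j) = signed_sum (star V i) (opposite X i) f"
proof -
  have "signed_sum (star V i) (opposite X i) f = (\<Sum>j\<in>V - {i}. of_bool (f {i, j}) * X j)"
    unfolding signed_sum_def by (rule sum_star[OF i, where g = "\<lambda>e y. of_bool (f e) * y"])
  also have "\<dots> = (\<Sum>j\<in>V - {i}. of_bool ({i, j} \<in> graph_of V f) * X j)"
    using i by (intro sum.cong) (auto simp: graph_of_def doubleton_in_all_edges)
  finally show ?thesis using sum_neighbors[OF V graph_of_subset[of V f] i, of X] by simp
qed

lemma abs_majority_step_le: "\<bar>real_of_int (majority_step E X i)\<bar> \<le> 1"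
  by (simp add: majority_step_def sgn_if)

text \<open>Given initial opinions with sum at least \<open>sqrt n / 8\<close>, each first vote has a bias of order
  \<open>sqrt p\<close>.\<close>

lemma expected_first_vote:
  fixes p :: real and V :: "'a set"
  defines "n \<equiv> card V"
  assumes V: "finite V" and p: "p \<in> {0..1}" and X: "opinions V X" and i: "i \<in> V"
    and np: "1 \<le> n * p" and pn: "1024 \<le> p * sqrt n" and n: "16 \<le> sqrt n"
    and maj: "sqrt n / 8 \<le> (\<Sum>j\<in>V. real_of_int (X j))"
  shows "sqrt p / 2048 \<le> measure_pmf.expectation (random_graph V p) (\<lambda>E. real_of_int (majority_step E X i))"
proof -
  let ?M = "Pi_pmf (all_edges V) False (\<lambda>_. bernoulli_pmf p)"
  let ?MS = "Pi_pmf (star V i) False (\<lambda>_. bernoulli_pmf p)"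
  let ?y = "opposite X i"
  let ?s = "signed_sum (star V i) ?y"
  have star: "star V i \<subseteq> all_edges V" by (auto simp: star_def)
  have fstar: "finite (star V i)" using V star finite_subset[OF star] by simp
  have y: "?y e = 1 \<or> ?y e = - 1" if "e \<in> star V i" for e
    using that X by (auto simp: star_def opinions_def elim!: all_edges_cases)
  have "measure_pmf.prob ?M {f. ?s f \<le> 0} = measure_pmf.prob (signed_sum_pmf p (star V i) ?y) {..0}"
  proof -
    have "?s (\<lambda>e. if e \<in> star V i then f e else False) = ?s f" for f
      unfolding signed_sum_def by (intro sum.cong) auto
    then show ?thesis
      unfolding signed_sum_pmf_def Pi_pmf_subset[OF finite_all_edges[OF V] star]
      by (simp add: map_pmf_comp vimage_def)
  qed
  moreover have "p * (sqrt n / 16) / (112 * sqrt (n * p)) \<le>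
    1 - 2 * measure_pmf.prob (signed_sum_pmf p (star V i) ?y) {..0}"
  proof (rule majority_vote_bias[OF fstar y p])
    show "card (star V i) \<le> n" using card_star[OF V i] by (simp add: n_def)
    have "(\<Sum>e\<in>star V i. real_of_int (?y e)) = (\<Sum>j\<in>V - {i}. real_of_int (X j))"
      by (rule sum_star[OF i, where g = "\<lambda>e y. real_of_int y"])
    also have "\<dots> = (\<Sum>j\<in>V. real_of_int (X j)) - real_of_int (X i)"
      using V i by (simp add: sum_diff1)
    also have "\<dots> \<ge> sqrt n / 8 - 1"
      using maj X i by (auto simp: opinions_def)
    finally show "sqrt n / 16 \<le> (\<Sum>e\<in>star V i. real_of_int (?y e))"
      using n by simp
  qed (use np pn n in auto)
  moreover have "sqrt p / 2048 \<le> p * (sqrt n / 16) / (112 * sqrt (n * p))"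
  proof -
    have p0: "0 < p" using np p by (cases "p = 0") auto
    have n0: "0 < sqrt n" using n by linarith
    have "p * (sqrt n / 16) / (112 * sqrt (n * p)) = (sqrt p * sqrt p) * (sqrt n / 16) / (112 * (sqrt n * sqrt p))"
      using p0 by (simp add: real_sqrt_mult)
    also have "\<dots> = sqrt p / 1792"
    proof -
      have gen: "(x * x) * (r / 16) / (112 * (r * x)) = x / 1792" if "0 < x" "0 < r" for x r :: real
        using that by (simp add: field_simps)
      show ?thesis by (rule gen) (use p0 n0 in auto)
    qed
    finally have eq: "p * (sqrt n / 16) / (112 * sqrt (n * p)) = sqrt p / 1792" .
    show ?thesis unfolding eq using p0 by simp
  qed
  moreover have "1 - 2 * measure_pmf.prob ?M {f. ?s f \<le> 0} \<le>
      measure_pmf.expectation ?M (\<lambda>f. real_of_int (majority_step (graph_of V f) X i))"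
  proof -
    have "1 - 2 * measure_pmf.prob ?M {f. ?s f \<le> 0} =
        measure_pmf.expectation ?M (\<lambda>f. 1 - 2 * of_bool (?s f \<le> 0))"
      using V unfolding prob_eq_expectation_of_bool by (simp add: integrable_measure_pmf_finite)
    also have "\<dots> \<le> measure_pmf.expectation ?M (\<lambda>f. real_of_int (majority_step (graph_of V f) X i))"
    proof (rule expectation_mono_finite)
      fix f
      show "1 - 2 * of_bool (?s f \<le> 0) \<le> real_of_int (majority_step (graph_of V f) X i)"
      proof (cases "?s f \<le> 0")
        case True
        then show ?thesis using abs_majority_step_le[of "graph_of V f" X i] by simp
      next
        case False
        then show ?thesis
          using majority_step_eq[OF V graph_of_subset[of V f] i X] neighbor_sum_eq_signed_sum[OF V i, of X f]
          by simp
      qed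
    qed (use V in simp)
    finally show ?thesis .
  qed
  ultimately show ?thesis
    by (simp add: random_graph_eq)
qed

lemma majority_step_cong_neighbors:
  "neighbors E i = neighbors E' i \<Longrightarrow> majority_step E X i = majority_step E' X i"
  by (simp add: majority_step_def odd_neighborhood_def)

text \<open>The votes of \<open>i\<close> and \<open>j\<close> share only the edge between them, and this edge matters to \<open>i\<close> only
  when the other neighbors are almost tied.\<close>

lemma first_vote_covariance:
  fixes p :: real
  assumes V: "finite V" and p: "p \<in> {0..1}" and X: "opinions V X"
    and ij: "i \<in> V" "j \<in> V" "i \<noteq> j"
  defines "G \<equiv> random_graph V p" and "g \<equiv> \<lambda>i E. real_of_int (majority_step E X i)"
  shows "measure_pmf.expectation G (\<lambda>E. g i E * g j E)
      - measure_pmf.expectation G (g i) * measure_pmf.expectation G (g j)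
    \<le> 4 * p * measure_pmf.prob G {E. \<bar>\<Sum>l\<in>neighbors E i - {j}. real_of_int (X l)\<bar> \<le> 1}"
proof -
  let ?a = "{i, j}"
  let ?M = "Pi_pmf (all_edges V) False (\<lambda>_. bernoulli_pmf p)"
  let ?g = "\<lambda>i f. g i (graph_of V f)"
  let ?Q = "\<lambda>E. \<bar>\<Sum>l\<in>neighbors E i - {j}. real_of_int (X l)\<bar> \<le> 1"
  have a: "?a \<in> all_edges V" using ij by (intro doubleton_in_all_edges)
  have dep: "?g i f = ?g i f'" if "i \<in> V" "\<And>e. e \<in> star V i \<Longrightarrow> f e = f' e" for i f f'
  proof -
    have "neighbors (graph_of V f) i = neighbors (graph_of V f') i"
      using that(2) unfolding neighbors_eq[OF graph_of_subset that(1)]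
      by (auto simp: graph_of_def star_def)
    then show ?thesis unfolding g_def by (metis majority_step_cong_neighbors)
  qed
  have "measure_pmf.expectation ?M (\<lambda>f. ?g i f * ?g j f)
      - measure_pmf.expectation ?M (?g i) * measure_pmf.expectation ?M (?g j)
    \<le> 4 * p * measure_pmf.prob ?M {f. ?g i (f(?a := True)) \<noteq> ?g i (f(?a := False))}"
  proof (rule covariance_shared_bit[where A = "star V i - {?a}" and B = "star V j - {?a}"])
    show "(star V i - {?a}) \<inter> (star V j - {?a}) = {}"
      using ij by (auto simp: star_def elim!: all_edges_cases)
    show "?g i f = ?g i f'" if "\<And>e. e \<in> insert ?a (star V i - {?a}) \<Longrightarrow> f e = f' e" for f f'
      using that by (intro dep ij) auto
    show "?g j f = ?g j f'" if "\<And>e. e \<in> insert ?a (star V j - {?a}) \<Longrightarrow> f e = f' e" for f f'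
      using that by (intro dep ij) auto
  qed (use V p a in \<open>auto simp: g_def abs_majority_step_le star_def\<close>)
  also have "measure_pmf.prob ?M {f. ?g i (f(?a := True)) \<noteq> ?g i (f(?a := False))}
      \<le> measure_pmf.prob ?M {f. ?Q (graph_of V f)}"
  proof (intro measure_pmf.finite_measure_mono subsetI CollectI)
    fix f assume "f \<in> {f. ?g i (f(?a := True)) \<noteq> ?g i (f(?a := False))}"
    then have neq: "?g i (f(?a := True)) \<noteq> ?g i (f(?a := False))" by simp
    define N where "N = neighbors (graph_of V f) i - {j}"
    have Nf: "finite N" "j \<notin> N" using V ij by (auto simp: N_def neighbors_eq[OF graph_of_subset])
    have NT: "neighbors (graph_of V (f(?a := True))) i = insert j N"
      using ij a unfolding N_def neighbors_eq[OF graph_of_subset ij(1)]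
      by (auto simp: graph_of_def doubleton_eq_iff)
    have NF: "neighbors (graph_of V (f(?a := False))) i = N"
      using ij a unfolding N_def neighbors_eq[OF graph_of_subset ij(1)]
      by (auto simp: graph_of_def doubleton_eq_iff)
    define s where "s = (\<Sum>l\<in>N. X l)"
    have "majority_step (graph_of V (f(?a := True))) X i
        = (if X j + s > 0 then 1 else if X j + s < 0 then - 1 else X i)"
      using majority_step_eq[OF V graph_of_subset[of V "f(?a := True)"] ij(1) X] Nf
      unfolding NT s_def by simp
    moreover have "majority_step (graph_of V (f(?a := False))) X i
        = (if s > 0 then 1 else if s < 0 then - 1 else X i)"
      using majority_step_eq[OF V graph_of_subset[of V "f(?a := False)"] ij(1) X]
      unfolding NF s_def .
    ultimately have "(if X j + s > 0 then 1 else if X j + s < 0 then - 1 else X i) \<noteq>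
        (if s > 0 then 1 else if s < 0 then - 1 else X i)"
      using neq by (simp only: g_def of_int_eq_iff not_False_eq_True) 
    moreover have "X j = 1 \<or> X j = - 1" using X ij by (auto simp: opinions_def)
    ultimately have "\<bar>s\<bar> \<le> 1" by (auto split: if_splits)
    then have "real_of_int \<bar>s\<bar> \<le> 1" by linarith
    then show "?Q (graph_of V f)" by (simp add: s_def N_def)
  qed simp
  finally show ?thesis
    using p by (simp add: G_def random_graph_eq vimage_def mult_left_mono)
qed

text \<open>Averaged over the opinions, almost ties are rare, by anti-concentration of the sum of the
  opinions of the neighbors.\<close>

lemma almost_tie_average:
  fixes p :: real and V :: "'a set"
  defines "n \<equiv> card V"
  assumes V: "finite V" and p: "p \<in> {0..1}" and i: "i \<in> V" and n: "4 \<le> n" and np: "0 < p * n"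
  shows "measure_pmf.expectation (random_opinions V) (\<lambda>X.
      measure_pmf.prob (random_graph V p) {E. \<bar>\<Sum>l\<in>neighbors E i - {j}. real_of_int (X l)\<bar> \<le> 1})
    \<le> exp (- (p * n / 128)) + 3 / sqrt (p * n / 2)"
proof -
  let ?G = "random_graph V p" and ?O = "random_opinions V"
  let ?Q = "\<lambda>E X. \<bar>\<Sum>l\<in>neighbors E i - {j}. real_of_int (X l)\<bar> \<le> 1"
  let ?low = "\<lambda>E. real (card (neighbors E i)) < p * n / 2"
  have "measure_pmf.expectation ?O (\<lambda>X. measure_pmf.prob ?G {E. ?Q E X})
      = measure_pmf.prob (pair_pmf ?O ?G) {z. ?Q (snd z) (fst z)}"
    using V by (subst prob_pair_pmf_finite) auto
  also have "\<dots> = measure_pmf.prob (pair_pmf ?G ?O) {z. ?Q (fst z) (snd z)}"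
    by (subst pair_commute_pmf) (simp add: vimage_def case_prod_beta)
  also have "\<dots> = measure_pmf.expectation ?G (\<lambda>E. measure_pmf.prob ?O {X. ?Q E X})"
    using V by (subst prob_pair_pmf_finite) auto
  also have "\<dots> \<le> measure_pmf.expectation ?G (\<lambda>E. of_bool (?low E) + 3 / sqrt (p * n / 2))"
  proof (rule expectation_mono_finite)
    fix E assume E: "E \<in> set_pmf ?G"
    have N: "neighbors E i \<subseteq> V" "finite (neighbors E i)"
      using V by (auto simp: neighbors_eq[OF random_graph_subset[OF V E] i])
    show "measure_pmf.prob ?O {X. ?Q E X} \<le> of_bool (?low E) + 3 / sqrt (p * n / 2)"
    proof (cases "?low E")
      case True
      then show ?thesis
        using measure_pmf.prob_le_1[of ?O "{X. ?Q E X}"] np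
        by (simp add: add_increasing2)
    next
      case False
      have "measure_pmf.prob ?O {X. ?Q E X} \<le> (2 * 1 + 1) / sqrt (real (card (neighbors E i - {j}) + 1))"
        using N by (intro prob_opinion_sum_le V) auto
      also have "\<dots> \<le> 3 / sqrt (p * n / 2)"
      proof -
        have "card (neighbors E i) \<le> card (neighbors E i - {j}) + 1"
          using N by (simp add: card_Diff_singleton_if) arith
        then have "real (card (neighbors E i)) \<le> real (card (neighbors E i - {j}) + 1)"
          by (simp only: of_nat_le_iff)
        then have "sqrt (p * n / 2) \<le> sqrt (real (card (neighbors E i - {j}) + 1))"
          using False by (intro real_sqrt_le_mono) simp
        then show ?thesis using np by (intro frac_le) auto
      qed
      finally show ?thesis using False by simp
    qed
  qed (use V in simp)
  also have "\<dots> = measure_pmf.prob ?G {E. ?low E} + 3 / sqrt (p * n / 2)"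
    using V unfolding prob_eq_expectation_of_bool
    by (simp add: integrable_measure_pmf_finite)
  also have "measure_pmf.prob ?G {E. ?low E} \<le> exp (- (p * n / 128))"
    using prob_small_degree[OF V p i] n by (simp add: n_def)
  finally show ?thesis by simp
qed

lemma chebyshev_lower_tail:
  fixes T :: "'a \<Rightarrow> real"
  assumes M: "finite (set_pmf M)" and a: "0 < a" "2 * a \<le> measure_pmf.expectation M T"
  shows "measure_pmf.prob M {x. T x < a}
    \<le> measure_pmf.expectation M (\<lambda>x. (T x - measure_pmf.expectation M T)\<^sup>2) / a\<^sup>2"
proof -
  let ?m = "measure_pmf.expectation M T"
  have "measure_pmf.prob M {x. T x < a} \<le> measure_pmf.expectation M (\<lambda>x. (T x - ?m)\<^sup>2 / a\<^sup>2)"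
    unfolding prob_eq_expectation_of_bool
  proof (rule expectation_mono_finite[OF M])
    fix x
    have "a\<^sup>2 \<le> (T x - ?m)\<^sup>2" if "T x < a"
    proof -
      have "a\<^sup>2 \<le> (?m - T x)\<^sup>2" using that a by (intro power_mono) auto
      then show ?thesis by (simp add: power2_commute)
    qed
    then show "of_bool (x \<in> {x. T x < a}) \<le> (T x - ?m)\<^sup>2 / a\<^sup>2"
      using a by auto
  qed
  then show ?thesis by simp
qed

lemma variance_sum:
  fixes g :: "'i \<Rightarrow> 'a \<Rightarrow> real"
  assumes M: "finite (set_pmf M)"
  shows "measure_pmf.expectation M (\<lambda>x. ((\<Sum>i\<in>V. g i x) - measure_pmf.expectation M (\<lambda>x. \<Sum>i\<in>V. g i x))\<^sup>2)
    = (\<Sum>i\<in>V. \<Sum>j\<in>V. measure_pmf.expectation M (\<lambda>x. g i x * g j x)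
        - measure_pmf.expectation M (g i) * measure_pmf.expectation M (g j))"
proof -
  let ?m = "\<lambda>i. measure_pmf.expectation M (g i)"
  note int = integrable_measure_pmf_finite[OF M]
  have "((\<Sum>i\<in>V. g i x) - measure_pmf.expectation M (\<lambda>x. \<Sum>i\<in>V. g i x))\<^sup>2 =
      (\<Sum>i\<in>V. \<Sum>j\<in>V. (g i x - ?m i) * (g j x - ?m j))" for x
    by (simp add: int power2_eq_square sum_product flip: sum_subtractf)
  moreover have "measure_pmf.expectation M (\<lambda>x. (g i x - ?m i) * (g j x - ?m j)) =
      measure_pmf.expectation M (\<lambda>x. g i x * g j x) - ?m i * ?m j" for i j
    by (simp add: int algebra_simps)
  ultimately show ?thesis by (simp add: int)
qed

lemma first_vote_small_bias:
  fixes p :: real and V :: "'a set"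
  defines "n \<equiv> card V"
  assumes V: "finite V" and p: "p \<in> {0..1}" and X: "opinions V X"
    and np: "1 \<le> n * p" and pn: "1024 \<le> p * sqrt n" and n: "16 \<le> sqrt n"
    and maj: "sqrt n / 8 \<le> (\<Sum>j\<in>V. real_of_int (X j))"
  shows "measure_pmf.prob (random_graph V p)
      {E. (\<Sum>i\<in>V. real_of_int (majority_step E X i)) < n * sqrt p / 4096}
    \<le> 2^24 / (n * (n * p)) * (n + (\<Sum>i\<in>V. \<Sum>j\<in>V - {i}. 4 * p *
        measure_pmf.prob (random_graph V p) {E. \<bar>\<Sum>l\<in>neighbors E i - {j}. real_of_int (X l)\<bar> \<le> 1}))"
    (is "?lhs \<le> _")
proof -
  let ?piv = "\<lambda>i j. 4 * p *
    measure_pmf.prob (random_graph V p) {E. \<bar>\<Sum>l\<in>neighbors E i - {j}. real_of_int (X l)\<bar> \<le> 1}"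
  let ?G = "random_graph V p"
  let ?g = "\<lambda>i E. real_of_int (majority_step E X i)"
  let ?m = "\<lambda>i. measure_pmf.expectation ?G (?g i)"
  let ?T = "\<lambda>E. \<Sum>i\<in>V. ?g i E"
  let ?cov = "\<lambda>i j. measure_pmf.expectation ?G (\<lambda>E. ?g i E * ?g j E) - ?m i * ?m j"
  have p0: "0 < p" using np p by (cases "p = 0") auto
  have n0: "0 < real n" using n by (cases "n = 0") auto
  have fG: "finite (set_pmf ?G)" using V by simp
  have "2 * (n * sqrt p / 4096) = (\<Sum>i\<in>V. sqrt p / 2048)" by (simp add: n_def)
  also have "\<dots> \<le> (\<Sum>i\<in>V. ?m i)"
    using np pn n maj by (intro sum_mono expected_first_vote V p X) (auto simp: n_def)
  also have "\<dots> = measure_pmf.expectation ?G ?T"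
    by (simp add: integrable_measure_pmf_finite[OF fG])
  finally have "?lhs \<le> measure_pmf.expectation ?G (\<lambda>E. (?T E - measure_pmf.expectation ?G ?T)\<^sup>2)
      / (n * sqrt p / 4096)\<^sup>2"
    using p0 n0 by (intro chebyshev_lower_tail fG) auto
  also have "measure_pmf.expectation ?G (\<lambda>E. (?T E - measure_pmf.expectation ?G ?T)\<^sup>2)
      = (\<Sum>i\<in>V. \<Sum>j\<in>V. ?cov i j)"
    by (rule variance_sum[OF fG])
  also have "\<dots> = (\<Sum>i\<in>V. ?cov i i + (\<Sum>j\<in>V - {i}. ?cov i j))"
    using V by (intro sum.cong refl) (simp add: sum.remove)
  also have "\<dots> \<le> (\<Sum>i\<in>V. 1 + (\<Sum>j\<in>V - {i}. ?piv i j))"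
  proof (intro sum_mono add_mono)
    fix i assume i: "i \<in> V"
    have "measure_pmf.expectation ?G (\<lambda>E. ?g i E * ?g i E) \<le> measure_pmf.expectation ?G (\<lambda>E. 1)"
    proof (rule expectation_mono_finite[OF fG])
      fix E
      have "\<bar>?g i E\<bar> * \<bar>?g i E\<bar> \<le> 1" by (intro mult_le_one abs_majority_step_le abs_ge_zero)
      then show "?g i E * ?g i E \<le> 1" by simp
    qed
    then have "measure_pmf.expectation ?G (\<lambda>E. ?g i E * ?g i E) \<le> 1" by simp
    then show "?cov i i \<le> 1" using zero_le_square[of "?m i"] by linarith
    fix j assume "j \<in> V - {i}"
    then show "?cov i j \<le> ?piv i j" using i by (intro first_vote_covariance V p X) auto
  qed
  also have "\<dots> = n + (\<Sum>i\<in>V. \<Sum>j\<in>V - {i}. ?piv i j)"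
    by (simp add: sum.distrib n_def)
  finally have bound: "?lhs \<le> (n + (\<Sum>i\<in>V. \<Sum>j\<in>V - {i}. ?piv i j)) / (n * sqrt p / 4096)\<^sup>2"
    by (simp add: divide_right_mono)
  have sq: "(n * sqrt p / 4096)\<^sup>2 = n * (n * p) / 2^24"
    using p0 by (simp add: power_mult_distrib power_divide power2_eq_square[of "real n"])
  have swap: "x / (y / z) = z / y * x" for x y z :: real by simp
  show ?thesis using bound unfolding sq swap .
qed

section \<open>Unanimity after four steps\<close>

text \<open>The last summand is the Chebyshev bound for the sum of the first votes; it still depends on
  the initial opinions through the probabilities of almost ties.\<close>

lemma prob_not_unanimous_fixed_opinions:
  fixes p :: real and V :: "'a set"
  defines "n \<equiv> card V"
  assumes V: "finite V" and p: "p \<in> {0..1}" and X: "opinions V X"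
    and np2: "10^12 \<le> n * p\<^sup>2" and n: "256 \<le> n"
    and maj: "sqrt n / 8 \<le> (\<Sum>j\<in>V. real_of_int (X j))"
  shows "measure_pmf.prob (random_graph V p) {E. \<not> (\<forall>i\<in>V. majority_dynamics E X 4 i = 1)}
    \<le> 4 ^ n * exp (- 2 * real n) + n * exp (- (p * n / 128))
      + 2^24 / (n * (n * p)) * (n + (\<Sum>i\<in>V. \<Sum>j\<in>V - {i}. 4 * p *
        measure_pmf.prob (random_graph V p) {E. \<bar>\<Sum>l\<in>neighbors E i - {j}. real_of_int (X l)\<bar> \<le> 1}))"
proof -
  let ?G = "random_graph V p"
  let ?B1 = "{E. \<not> small_discrepancy V p E}"
  let ?B2 = "{E. \<not> large_degrees V p E}"
  let ?B3 = "{E. (\<Sum>i\<in>V. real_of_int (majority_step E X i)) < n * sqrt p / 4096}"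
  have p0: "0 < p" using np2 p by (cases "p = 0") auto
  have "(p * sqrt n)\<^sup>2 = n * p\<^sup>2" by (simp add: power_mult_distrib)
  then have "(1024 :: real)\<^sup>2 \<le> (p * sqrt n)\<^sup>2" using np2 by simp
  then have pn: "1024 \<le> p * sqrt n" by (rule power2_le_imp_le) (use p0 in simp)
  have "sqrt (16\<^sup>2) \<le> sqrt n" using n by (intro real_sqrt_le_mono) simp
  then have sn: "16 \<le> sqrt n" by simp
  have "p\<^sup>2 \<le> p" using p by (simp add: power2_eq_square mult_left_le)
  then have "n * p\<^sup>2 \<le> n * p" by (intro mult_left_mono) auto
  then have np: "1 \<le> n * p" using np2 by simp
  have "measure_pmf.prob ?G {E. \<not> (\<forall>i\<in>V. majority_dynamics E X 4 i = 1)}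
      \<le> measure_pmf.prob ?G ((?B1 \<union> ?B2) \<union> ?B3)"
  proof (rule measure_pmf.finite_measure_mono_AE)
    show "AE E in ?G. E \<in> {E. \<not> (\<forall>i\<in>V. majority_dynamics E X 4 i = 1)} \<longrightarrow> E \<in> (?B1 \<union> ?B2) \<union> ?B3"
    proof (rule AE_pmfI, rule impI, rule ccontr)
      fix E assume G: "E \<in> set_pmf ?G" and bad: "E \<in> {E. \<not> (\<forall>i\<in>V. majority_dynamics E X 4 i = 1)}"
        and "E \<notin> (?B1 \<union> ?B2) \<union> ?B3"
      then have good: "small_discrepancy V p E" "large_degrees V p E"
        "n * sqrt p / 4096 \<le> (\<Sum>i\<in>V. real_of_int (majority_step E X i))" by auto
      have E: "E \<subseteq> all_edges V" by (rule random_graph_subset[OF V G])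
      have "majority_dynamics E X 4 = majority_dynamics E (majority_step E X) 3"
        by (simp add: numeral_eq_Suc)
      moreover have "majority_dynamics E (majority_step E X) 3 i = 1" if "i \<in> V" for i
        using np2 p good that p0
        by (intro unanimous_after_three_steps[OF V E opinions_majority_step[OF V E X]]) (auto simp: n_def)
      ultimately show False using bad by simp
    qed
  qed simp
  also have "\<dots> \<le> measure_pmf.prob ?G ?B1 + measure_pmf.prob ?G ?B2 + measure_pmf.prob ?G ?B3"
    by (intro order_trans[OF measure_Un_le] add_mono order_refl measure_Un_le) auto
  also have "measure_pmf.prob ?G ?B1 \<le> 4 ^ n * exp (- 2 * real n)"
    unfolding n_def by (rule prob_not_small_discrepancy[OF V p])
  also have "measure_pmf.prob ?G ?B2 \<le> n * exp (- (p * n / 128))"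
    using n unfolding n_def by (intro prob_not_large_degrees V p) auto
  also have "measure_pmf.prob ?G ?B3 \<le> 2^24 / (n * (n * p)) * (n + (\<Sum>i\<in>V. \<Sum>j\<in>V - {i}. 4 * p *
        measure_pmf.prob ?G {E. \<bar>\<Sum>l\<in>neighbors E i - {j}. real_of_int (X l)\<bar> \<le> 1}))"
    using np pn sn maj unfolding n_def by (intro first_vote_small_bias V p X)
  finally show ?thesis by simp
qed

text \<open>The summands account for large discrepancy, for a vertex of small degree, for a nearly balanced
  start, and for a sum of first votes far below its conditional mean.\<close>

lemma prob_not_unanimous:
  fixes p :: real and V :: "'a set"
  defines "n \<equiv> card V"
  assumes V: "finite V" and p: "p \<in> {0..1}" and np2: "10^12 \<le> n * p\<^sup>2" and n: "256 \<le> n"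
  shows "measure_pmf.prob (pair_pmf (random_graph V p) (random_opinions V))
      {(E, X). \<not> (\<forall>i\<in>V. real_of_int (majority_dynamics E X 4 i) = sgn (mean_opinion V X))}
    \<le> 4 ^ n * exp (- 2 * real n) + n * exp (- (p * n / 128)) + (sqrt n / 4 + 1) / sqrt n
      + 2^24 * (1 / (n * p) + 4 * (exp (- (p * n / 128)) + 3 / sqrt (p * n / 2)))"
proof -
  let ?G = "random_graph V p" and ?O = "random_opinions V"
  let ?F = "\<lambda>E X. \<forall>i\<in>V. real_of_int (majority_dynamics E X 4 i) = sgn (mean_opinion V X)"
  let ?piv = "\<lambda>X i j. measure_pmf.prob ?G {E. \<bar>\<Sum>l\<in>neighbors E i - {j}. real_of_int (X l)\<bar> \<le> 1}"
  let ?S = "\<lambda>X. \<Sum>j\<in>V. real_of_int (X j)"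
  define K where "K = exp (- (p * n / 128)) + 3 / sqrt (p * n / 2)"
  define d where "d = 4 ^ n * exp (- 2 * real n) + n * exp (- (p * n / 128))"
  define v where "v X = 2^24 / (n * (n * p)) * (n + (\<Sum>i\<in>V. \<Sum>j\<in>V - {i}. 4 * p * ?piv X i j))" for X
  have p0: "0 < p" using np2 p by (cases "p = 0") auto
  have n0: "0 < n" using n by simp
  have fO: "finite (set_pmf ?O)" using V by simp
  have d0: "0 \<le> d" by (simp add: d_def)
  have v0: "0 \<le> v X" for X
    unfolding v_def using p0 by (intro mult_nonneg_nonneg add_nonneg_nonneg sum_nonneg) auto
  \<comment> \<open>The graph is random while the opinions \<open>X\<close> are fixed; the average over \<open>X\<close> comes after.\<close>
  have fixed: "measure_pmf.prob ?G {E. \<not> ?F E X} \<le> of_bool (\<bar>?S X\<bar> \<le> sqrt n / 8) + (d + v X)"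
    if "X \<in> set_pmf ?O" for X
  proof -
    have X: "opinions V X" by (rule opinions_random_opinions[OF V that])
    consider "\<bar>?S X\<bar> \<le> sqrt n / 8" | "sqrt n / 8 < ?S X" | "sqrt n / 8 < - ?S X" by linarith
    then show ?thesis
    proof cases
      case 1
      then have "of_bool (\<bar>?S X\<bar> \<le> sqrt n / 8) = (1 :: real)" by simp
      then show ?thesis
        using measure_pmf.prob_le_1[of ?G "{E. \<not> ?F E X}"] d0 v0[of X] by linarith
    next
      case 2
      have "0 \<le> sqrt n / 8" by simp
      then have "0 < ?S X" using 2 by linarith
      then have "sgn (mean_opinion V X) = 1" using n0 by (simp add: mean_opinion_def n_def)
      then have "measure_pmf.prob ?G {E. \<not> ?F E X} =
          measure_pmf.prob ?G {E. \<not> (\<forall>i\<in>V. majority_dynamics E X 4 i = 1)}"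
        by simp
      also have "\<dots> \<le> d + v X"
        unfolding d_def v_def n_def using 2 np2 n
        by (intro prob_not_unanimous_fixed_opinions V p X) (auto simp: n_def)
      finally show ?thesis by simp
    next
      case 3
      \<comment> \<open>The dynamics commutes with exchanging the two opinions.\<close>
      define Y where "Y = (\<lambda>j. - X j)"
      have Y: "opinions V Y" using X by (auto simp: opinions_def Y_def)
      have SY: "?S Y = - ?S X" by (simp add: Y_def sum_negf)
      have "0 \<le> sqrt n / 8" by simp
      then have "?S X < 0" using 3 by linarith
      then have "sgn (mean_opinion V X) = - 1"
        using n0 by (simp add: mean_opinion_def n_def divide_less_0_iff)
      moreover have "real_of_int (majority_dynamics E X 4 i) = - 1 \<longleftrightarrow> majority_dynamics E Y 4 i = 1" for E i
      proof -
        have "majority_dynamics E Y 4 i = - majority_dynamics E X 4 i"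
          unfolding Y_def by (simp only: majority_dynamics_uminus)
        then show ?thesis by linarith
      qed
      ultimately have "measure_pmf.prob ?G {E. \<not> ?F E X} =
          measure_pmf.prob ?G {E. \<not> (\<forall>i\<in>V. majority_dynamics E Y 4 i = 1)}"
        by simp
      also have "\<dots> \<le> d + v Y"
        unfolding d_def v_def n_def using 3 np2 n SY
        by (intro prob_not_unanimous_fixed_opinions V p Y) (auto simp: n_def)
      also have "v Y = v X"
        by (simp add: v_def Y_def sum_negf)
      finally show ?thesis by simp
    qed
  qed
  have "measure_pmf.prob (pair_pmf ?G ?O) {(E, X). \<not> ?F E X}
      = measure_pmf.prob (pair_pmf ?O ?G) {z. \<not> ?F (snd z) (fst z)}"
    by (subst pair_commute_pmf) (simp add: vimage_def case_prod_beta)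
  also have "\<dots> = measure_pmf.expectation ?O (\<lambda>X. measure_pmf.prob ?G {E. \<not> ?F E X})"
    using V by (subst prob_pair_pmf_finite) auto
  also have "\<dots> \<le> measure_pmf.expectation ?O (\<lambda>X. of_bool (\<bar>?S X\<bar> \<le> sqrt n / 8) + (d + v X))"
    by (rule expectation_mono_finite[OF fO fixed])
  also have "\<dots> = measure_pmf.prob ?O {X. \<bar>?S X\<bar> \<le> sqrt n / 8} + (d + measure_pmf.expectation ?O v)"
    unfolding prob_eq_expectation_of_bool by (simp add: integrable_measure_pmf_finite[OF fO])
  also have "measure_pmf.prob ?O {X. \<bar>?S X\<bar> \<le> sqrt n / 8} \<le> (2 * (sqrt n / 8) + 1) / sqrt (real (card V + 1))"
    by (intro prob_opinion_sum_le V) auto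
  also have "\<dots> \<le> (sqrt n / 4 + 1) / sqrt n"
    using n0 by (intro frac_le) (auto simp: n_def)
  also have "measure_pmf.expectation ?O v \<le> 2^24 * (1 / (n * p) + 4 * K)"
  proof -
    have "measure_pmf.expectation ?O v = 2^24 / (n * (n * p)) *
        (n + (\<Sum>i\<in>V. \<Sum>j\<in>V - {i}. 4 * p * measure_pmf.expectation ?O (\<lambda>X. ?piv X i j)))"
      unfolding v_def by (simp add: integrable_measure_pmf_finite[OF fO])
    also have "\<dots> \<le> 2^24 / (n * (n * p)) * (n + (\<Sum>i\<in>V. \<Sum>j\<in>V. 4 * p * K))"
    proof (intro mult_left_mono add_left_mono sum_mono)
      fix i assume i: "i \<in> V"
      have K: "measure_pmf.expectation ?O (\<lambda>X. ?piv X i j) \<le> K" for j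
        unfolding K_def n_def using n n0 p0 by (intro almost_tie_average V p i) (auto simp: n_def)
      have K0: "0 \<le> K" using p0 by (simp add: K_def)
      have "(\<Sum>j\<in>V - {i}. 4 * p * measure_pmf.expectation ?O (\<lambda>X. ?piv X i j)) \<le> (\<Sum>j\<in>V - {i}. 4 * p * K)"
        using K p0 by (intro sum_mono mult_left_mono) auto
      also have "\<dots> \<le> (\<Sum>j\<in>V. 4 * p * K)"
        using V K0 p0 by (intro sum_mono2) auto
      finally show "(\<Sum>j\<in>V - {i}. 4 * p * measure_pmf.expectation ?O (\<lambda>X. ?piv X i j)) \<le> (\<Sum>j\<in>V. 4 * p * K)" .
    qed (use p0 in auto)
    also have "(\<Sum>i\<in>V. \<Sum>j\<in>V. 4 * p * K) = n * n * (4 * p * K)"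
      by (simp add: n_def)
    also have "2^24 / (n * (n * p)) * (n + n * n * (4 * p * K)) = 2^24 * (1 / (n * p) + 4 * K)"
      using n0 p0 by (simp add: field_simps)
    finally show ?thesis .
  qed
  finally show ?thesis by (simp add: d_def K_def)
qed

text \<open>The limit \<open>1/4\<close> is the bound on the probability that the initial opinions sum to at most
  \<open>sqrt n / 8\<close> in absolute value; everything else vanishes.\<close>

lemma failure_bound_small:
  "\<forall>\<^sub>F n :: nat in at_top. (4/5) ^ n + n * exp (- (sqrt n / 128)) + (sqrt n / 4 + 1) / sqrt n
      + 2^24 * (1 / sqrt n + 4 * (exp (- (sqrt n / 128)) + 3 / sqrt (sqrt n / 2))) \<le> (0.6 :: real)"
proof -
  have "(\<lambda>n :: nat. (4/5) ^ n + n * exp (- (sqrt n / 128)) + (sqrt n / 4 + 1) / sqrt n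
      + 2^24 * (1 / sqrt n + 4 * (exp (- (sqrt n / 128)) + 3 / sqrt (sqrt n / 2)))) \<longlonglongrightarrow> (1/4 :: real)"
    by real_asymp
  then show ?thesis
    by (rule eventually_mono[OF order_tendstoD(2)[of _ _ _ "0.6"]]) auto
qed

theorem theorem2:
  shows "\<exists>n\<^sub>0::nat. \<exists>c::real. n\<^sub>0 > 0 \<and> c > 0 \<and>
    (\<forall>(n::nat) (p::real). n \<ge> n\<^sub>0 \<longrightarrow> odd n \<longrightarrow> p \<in> {0..1} \<longrightarrow> p \<ge> c * real n powr (-1/2) \<longrightarrow>
      measure_pmf.prob (pair_pmf (random_graph {..<n} p) (random_opinions {..<n}))
        {(E, X\<^sub>0). \<forall>i\<in>{..<n}. real_of_int (majority_dynamics E X\<^sub>0 4 i) = sgn (mean_opinion {..<n} X\<^sub>0)}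
      \<ge> 0.4)"
proof -
  obtain n1 :: nat where n1: "\<And>n :: nat. n1 \<le> n \<Longrightarrow>
      (4/5) ^ n + n * exp (- (sqrt n / 128)) + (sqrt n / 4 + 1) / sqrt n
      + 2^24 * (1 / sqrt n + 4 * (exp (- (sqrt n / 128)) + 3 / sqrt (sqrt n / 2))) \<le> (0.6 :: real)"
    using failure_bound_small by (auto simp: eventually_at_top_linorder)
  show ?thesis
  proof (intro exI conjI allI impI)
    fix n :: nat and p :: real
    assume n: "n1 + 256 \<le> n" and p: "p \<in> {0..1}" and c: "1000000 * real n powr (-1/2) \<le> p"
    let ?\<Omega> = "pair_pmf (random_graph {..<n} p) (random_opinions {..<n})"
    let ?A = "{(E, X\<^sub>0). \<forall>i\<in>{..<n}. real_of_int (majority_dynamics E X\<^sub>0 4 i) = sgn (mean_opinion {..<n} X\<^sub>0)}"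
    have n0: "0 < real n" using n by simp
    have sn: "0 < sqrt n" "sqrt n * sqrt n = n" using n0 by auto
    \<comment> \<open>The constant \<open>c = 10^6\<close> gives \<open>n p\<^sup>2 \<ge> 10^12\<close>.\<close>
    have "real n powr (-1/2) = 1 / sqrt n"
      using n0 by (simp add: powr_minus powr_half_sqrt inverse_eq_divide)
    then have "1000000 / sqrt n \<le> p" using c by simp
    then have psn: "1000000 \<le> p * sqrt n" using sn by (simp add: field_simps)
    then have "(1000000 :: real)\<^sup>2 \<le> (p * sqrt n)\<^sup>2" by (intro power_mono) auto
    moreover have "(p * sqrt n)\<^sup>2 = real n * p\<^sup>2" by (simp add: power_mult_distrib)
    ultimately have np2: "10^12 \<le> real n * p\<^sup>2" by simp
    have "1 * sqrt n \<le> (p * sqrt n) * sqrt n" using psn sn by (intro mult_right_mono) auto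
    also have "\<dots> = p * n" using sn(2) by (simp only: mult.assoc)
    finally have pn: "sqrt n \<le> p * n" by simp
    have e: "exp (- (p * n / 128)) \<le> exp (- (sqrt n / 128))" using pn by simp
    have "measure_pmf.prob ?\<Omega> (- ?A) \<le>
      4 ^ n * exp (- 2 * real n) + n * exp (- (p * n / 128)) + (sqrt n / 4 + 1) / sqrt n
      + 2^24 * (1 / (n * p) + 4 * (exp (- (p * n / 128)) + 3 / sqrt (p * n / 2)))"
    proof -
      have "- ?A = {(E, X). \<not> (\<forall>i\<in>{..<n}. real_of_int (majority_dynamics E X 4 i) = sgn (mean_opinion {..<n} X))}"
        by auto
      then show ?thesis
        using prob_not_unanimous[of "{..<n}" p] p np2 n by simp
    qed
    also have "\<dots> \<le> (4/5) ^ n + n * exp (- (sqrt n / 128)) + (sqrt n / 4 + 1) / sqrt n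
      + 2^24 * (1 / sqrt n + 4 * (exp (- (sqrt n / 128)) + 3 / sqrt (sqrt n / 2)))"
    proof (intro add_mono mult_left_mono order_refl e)
      have "5 \<le> 1 + 2 + (2 :: real)\<^sup>2 / 2" by (simp add: power2_eq_square)
      also have "\<dots> \<le> exp 2" by (rule exp_lower_Taylor_quadratic) simp
      finally have "4 * exp (- 2 :: real) \<le> 4/5" by (simp add: exp_minus field_simps)
      then have "(4 * exp (- 2 :: real)) ^ n \<le> (4/5) ^ n" by (intro power_mono) auto
      also have "(4 * exp (- 2 :: real)) ^ n = 4 ^ n * exp (- 2 * real n)"
        by (simp add: power_mult_distrib mult.commute flip: exp_of_nat_mult)
      finally show "4 ^ n * exp (- 2 * real n) \<le> (4/5) ^ n" .
      show "1 / (n * p) \<le> 1 / sqrt n" using pn sn by (intro frac_le) (auto simp: mult.commute)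
      show "3 / sqrt (p * n / 2) \<le> 3 / sqrt (sqrt n / 2)" using pn sn by (intro frac_le) auto
    qed auto
    also have "\<dots> \<le> 0.6" using n by (intro n1) simp
    finally have "measure_pmf.prob ?\<Omega> (- ?A) \<le> 0.6" .
    moreover have "measure_pmf.prob ?\<Omega> (- ?A) = 1 - measure_pmf.prob ?\<Omega> ?A"
      using measure_pmf.prob_compl[of ?A ?\<Omega>] by (simp add: Compl_eq_Diff_UNIV)
    ultimately show "measure_pmf.prob ?\<Omega> ?A \<ge> 0.4" by simp
  qed simp_all
qed

end
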